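(* Let $D$ be a UMT-domain and let $D[X]$ be the polynomial ring over $D$. Then $D$ is a VFD if and only if $D[X]$ is a VFD.
   Context: For an integral domain $R$ with quotient field $F$: an overring of $R$ is a subring of $F$ containing $R$. A nonzero nonunit $a\in R$ is a valuation element of $R$ if there is a valuation domain $V$ that is an overring of $R$ with $aV\cap R=aR$. $R$ is a VFD (valuation factorization domain) if every nonzero nonunit of $R$ is a finite product of valuation elements of $R$. For a nonzero fractional ideal $A$ of $R$ let $A^{-1}=\{x\in F\mid xA\subseteq R\}$, $A_v=(A^{-1})^{-1}$ and $A_t=\bigcup\{I_v\mid I\subseteq A,\ I$ a nonzero finitely generated fractional ideal$\}$. $A$ is a $t$-ideal if $A_t=A$. A maximal $t$-ideal is a $t$-ideal maximal among proper integral $t$-ideals. An upper to zero in $D[X]$ is a nonzero prime ideal $Q$ of $D[X]$ with $Q\cap D=(0)$. An integral domain $D$ is a UMT-domain if each upper to zero in $D[X]$ is a maximal $t$-ideal of $D[X]$. *)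

theory Defs
  imports "HOL-Computational_Algebra.Computational_Algebra"
begin

text \<open>
  The integral domain is a type \<open>'a :: idom\<close>, its quotient field is \<open>'a fract\<close>, and \<open>range to_fract\<close>
  is the copy of the domain inside its quotient field. Properties of the domain itself take an
  argument of type \<open>'a itself\<close>, so that \<open>VFD TYPE('a poly)\<close> speaks about the polynomial ring.
\<close>

subsection \<open>Valuation factorization domains\<close>

definition overring :: "'a::idom fract set \<Rightarrow> bool" where
  "overring V \<longleftrightarrow> range to_fract \<subseteq> V \<and> (\<forall>x\<in>V. \<forall>y\<in>V. x - y \<in> V \<and> x * y \<in> V)"

text \<open>An overring has the same quotient field as the domain, so the elements to be tested in the
  definition of a valuation domain are those of \<open>'a fract\<close>. The element \<open>0\<close> is harmless.\<close>

definition valuation_overring :: "'a::idom fract set \<Rightarrow> bool" where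
  "valuation_overring V \<longleftrightarrow> overring V \<and> (\<forall>x. x \<in> V \<or> inverse x \<in> V)"

definition valuation_element :: "'a::idom \<Rightarrow> bool" where
  "valuation_element a \<longleftrightarrow> a \<noteq> 0 \<and> \<not> a dvd 1 \<and>
     (\<exists>V. valuation_overring V \<and>
        (\<lambda>v. to_fract a * v) ` V \<inter> range to_fract = to_fract ` range (\<lambda>r. a * r))"

definition VFD :: "'a::idom itself \<Rightarrow> bool" where
  "VFD R \<longleftrightarrow> (\<forall>a::'a. a \<noteq> 0 \<longrightarrow> \<not> a dvd 1 \<longrightarrow>
     (\<exists>as. (\<forall>b\<in>set as. valuation_element b) \<and> a = prod_list as))"

subsection \<open>Fractional ideals and the \<open>t\<close>-operation\<close>

definition fract_scale :: "'a::idom \<Rightarrow> 'a fract \<Rightarrow> 'a fract" where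
  "fract_scale r x = to_fract r * x"

lemma module_fract_scale: "module fract_scale"
  by unfold_locales (simp_all add: fract_scale_def algebra_simps)

definition fractional_ideal :: "'a::idom fract set \<Rightarrow> bool" where
  "fractional_ideal A \<longleftrightarrow> module.subspace fract_scale A \<and>
     (\<exists>d. d \<noteq> 0 \<and> (\<forall>x\<in>A. to_fract d * x \<in> range to_fract))"

definition fg_fractional_ideal :: "'a::idom fract set \<Rightarrow> bool" where
  "fg_fractional_ideal A \<longleftrightarrow> fractional_ideal A \<and>
     (\<exists>S. finite S \<and> A = module.span fract_scale S)"

definition inv_ideal :: "'a::idom fract set \<Rightarrow> 'a fract set" where
  "inv_ideal A = {x. \<forall>a\<in>A. x * a \<in> range to_fract}"

definition v_closure :: "'a::idom fract set \<Rightarrow> 'a fract set" where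
  "v_closure A = inv_ideal (inv_ideal A)"

definition t_closure :: "'a::idom fract set \<Rightarrow> 'a fract set" where
  "t_closure A = \<Union> {v_closure I | I. I \<subseteq> A \<and> I \<noteq> {0} \<and> fg_fractional_ideal I}"

definition t_ideal :: "'a::idom fract set \<Rightarrow> bool" where
  "t_ideal A \<longleftrightarrow> fractional_ideal A \<and> A \<noteq> {0} \<and> t_closure A = A"

definition proper_integral_t_ideal :: "'a::idom fract set \<Rightarrow> bool" where
  "proper_integral_t_ideal A \<longleftrightarrow> t_ideal A \<and> A \<subset> range to_fract"

definition maximal_t_ideal :: "'a::idom fract set \<Rightarrow> bool" where
  "maximal_t_ideal M \<longleftrightarrow> proper_integral_t_ideal M \<and>
     (\<forall>N. proper_integral_t_ideal N \<longrightarrow> M \<subseteq> N \<longrightarrow> N = M)"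

subsection \<open>UMT-domains\<close>

lemma module_times: "module ((*) :: 'a::comm_ring_1 \<Rightarrow> 'a \<Rightarrow> 'a)"
  by unfold_locales (simp_all add: algebra_simps)

text \<open>The ideals of a ring are its submodules.\<close>

definition prime_ideal :: "'a::comm_ring_1 set \<Rightarrow> bool" where
  "prime_ideal P \<longleftrightarrow> module.subspace (*) P \<and> P \<noteq> UNIV \<and>
     (\<forall>a b. a * b \<in> P \<longrightarrow> a \<in> P \<or> b \<in> P)"

definition upper_to_zero :: "'a::idom poly set \<Rightarrow> bool" where
  "upper_to_zero Q \<longleftrightarrow> prime_ideal Q \<and> Q \<noteq> {0} \<and> Q \<inter> range (\<lambda>c. [:c:]) = {0}"

definition UMT_domain :: "'a::idom itself \<Rightarrow> bool" where
  "UMT_domain D \<longleftrightarrow> (\<forall>Q::'a poly set. upper_to_zero Q \<longrightarrow> maximal_t_ideal (to_fract ` Q))"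

end

theory Submission
  imports Defs
begin

text \<open>
  Suppose that \<open>D[X]\<close> is a VFD. A constant factors in \<open>D[X]\<close> into constants, and a valuation overring
  of \<open>D[X]\<close> restricts to one of \<open>D\<close>, so \<open>D\<close> is a VFD (\<open>VFD_if_VFD_poly\<close>).

  Suppose conversely that \<open>D\<close> is a VFD. The point is that \<open>D\<close> then has greatest common divisors in
  the strong sense that the cofactors satisfy \<open>(a', b')\<^sub>v = D\<close>. Two things are combined. The first is
  an invertibility property of two-generated ideals \<open>(a, x)\<close>. Since \<open>D\<close> is a UMT-domain, the upper to
  zero of the linear polynomial \<open>aX + x\<close> is a maximal \<open>t\<close>-ideal, which forces it to contain a
  polynomial \<open>f\<close> whose content \<open>c(f)\<close> satisfies \<open>c(f)\<^sub>v = D\<close>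
  (\<open>upper_to_zero_contains_v_primitive\<close>). A VFD is an intersection of valuation overrings, so the
  Gauss lemma over these overrings shows that the coefficients of \<open>f / (aX + x)\<close> multiply \<open>a\<close> and \<open>x\<close>
  into \<open>D\<close> (\<open>two_generated_ideal_v_invertible\<close>). The second is that the zero divisors modulo a
  valuation element form a prime \<open>t\<close>-ideal (\<open>common_zero_divisor_witness\<close>). Together they show
  that of two valuation elements one divides the other unless they are coprime in the strong sense
  (\<open>valuation_elements_comparable_or_v_coprime\<close>). Cancelling common factors in products of valuation
  elements gives the greatest common divisors, and hence every nonzero polynomial over \<open>D\<close> is a
  constant times a primitive one (\<open>VFD_content_primitive_part\<close>).

  A primitive polynomial splits into primitive polynomials that are irreducible over the quotient
  field. These are prime in \<open>D[X]\<close>, because a primitive factor can be cancelled from a divisibility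
  by a constant (\<open>v_primitive_cancel\<close>), and a prime element of positive degree is a valuation
  element: the localization at it is a discrete valuation ring. The constant in front is a product of
  valuation elements of \<open>D\<close>, and these remain valuation elements of \<open>D[X]\<close> by the Gauss extension of
  a valuation overring (\<open>valuation_element_const\<close>).
\<close>

section \<open>Fractions and valuation overrings\<close>

lemma fract_as_quotient:
  fixes x :: "'a::idom fract"
  obtains r s where "x = to_fract r / to_fract s" "s \<noteq> 0"
  by (cases x) (auto simp: Fract_conv_to_fract)

lemma quotient_in_range_iff:
  assumes "s \<noteq> 0"
  shows "to_fract r / to_fract s \<in> range to_fract \<longleftrightarrow> s dvd r"
proof
  assume "to_fract r / to_fract s \<in> range to_fract"
  then obtain t where "to_fract r / to_fract s = to_fract t" by auto
  hence "to_fract r = to_fract (s * t)" using assms by (simp add: field_simps)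
  thus "s dvd r" by (simp del: to_fract_mult)
next
  assume "s dvd r"
  then obtain t where "r = s * t" by auto
  thus "to_fract r / to_fract s \<in> range to_fract" using assms by simp
qed

lemma overringD:
  assumes "overring V"
  shows overring_to_fract: "to_fract r \<in> V"
    and overring_diff: "x \<in> V \<Longrightarrow> y \<in> V \<Longrightarrow> x - y \<in> V"
    and overring_mult: "x \<in> V \<Longrightarrow> y \<in> V \<Longrightarrow> x * y \<in> V"
  using assms by (auto simp: overring_def)

lemma overring_0: "overring V \<Longrightarrow> 0 \<in> V"
  using overring_to_fract[of V 0] by simp

lemma overring_1: "overring V \<Longrightarrow> 1 \<in> V"
  using overring_to_fract[of V 1] by simp

lemma overring_add:
  assumes "overring V" "x \<in> V" "y \<in> V"
  shows "x + y \<in> V"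
  using overring_diff[OF assms(1) assms(2) overring_diff[OF assms(1) overring_0[OF assms(1)] assms(3)]]
  by simp

lemma overring_sum:
  assumes "overring V" "\<And>i. i \<in> A \<Longrightarrow> f i \<in> V"
  shows "sum f A \<in> V"
  using assms(2) by (induction A rule: infinite_finite_induct)
    (auto intro: overring_0[OF assms(1)] overring_add[OF assms(1)])

lemma valuation_overring_overring: "valuation_overring V \<Longrightarrow> overring V"
  by (simp add: valuation_overring_def)

lemma valuation_overring_total:
  assumes "valuation_overring V"
  shows "x / y \<in> V \<or> y / x \<in> V"
  using assms by (metis inverse_divide valuation_overring_def)

text \<open>
  The equation \<open>aV \<inter> R = aR\<close> says that \<open>V\<close> decides divisibility by \<open>a\<close>. In this form it is used
  everywhere below.
\<close>

lemma valuation_element_iff: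
  "valuation_element a \<longleftrightarrow> a \<noteq> 0 \<and> \<not> a dvd 1 \<and>
     (\<exists>V. valuation_overring V \<and> (\<forall>r. to_fract r / to_fract a \<in> V \<longrightarrow> a dvd r))"
proof -
  have "(\<lambda>v. to_fract a * v) ` V \<inter> range to_fract = to_fract ` range (\<lambda>r. a * r) \<longleftrightarrow>
      (\<forall>r. to_fract r / to_fract a \<in> V \<longrightarrow> a dvd r)"
    if V: "valuation_overring V" and a: "a \<noteq> 0" for V
  proof
    assume eq: "(\<lambda>v. to_fract a * v) ` V \<inter> range to_fract = to_fract ` range (\<lambda>r. a * r)"
    show "\<forall>r. to_fract r / to_fract a \<in> V \<longrightarrow> a dvd r"
    proof (intro allI impI)
      fix r assume "to_fract r / to_fract a \<in> V"
      moreover have "to_fract r = to_fract a * (to_fract r / to_fract a)" using a by simp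
      ultimately have "to_fract r \<in> (\<lambda>v. to_fract a * v) ` V \<inter> range to_fract" by blast
      hence "to_fract r \<in> to_fract ` range (\<lambda>r. a * r)" using eq by blast
      thus "a dvd r" by (auto simp del: to_fract_mult)
    qed
  next
    assume *: "\<forall>r. to_fract r / to_fract a \<in> V \<longrightarrow> a dvd r"
    show "(\<lambda>v. to_fract a * v) ` V \<inter> range to_fract = to_fract ` range (\<lambda>r. a * r)"
    proof (intro equalityI subsetI)
      fix x assume "x \<in> (\<lambda>v. to_fract a * v) ` V \<inter> range to_fract"
      then obtain v r where "v \<in> V" "x = to_fract a * v" "x = to_fract r" by auto
      moreover from this have "to_fract r / to_fract a = v" using a by (simp add: field_simps)
      ultimately show "x \<in> to_fract ` range (\<lambda>r. a * r)" using * by blast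
    next
      fix x assume "x \<in> to_fract ` range (\<lambda>r. a * r)"
      then obtain r where "x = to_fract (a * r)" by blast
      hence "x = to_fract a * to_fract r" by simp
      moreover have "x \<in> range to_fract" using \<open>x \<in> _\<close> by auto
      ultimately show "x \<in> (\<lambda>v. to_fract a * v) ` V \<inter> range to_fract"
        using overring_to_fract[OF valuation_overring_overring[OF V]] by auto
    qed
  qed
  thus ?thesis unfolding valuation_element_def by (intro conj_cong ex_cong1 refl)
qed

lemma valuation_elementE:
  assumes "valuation_element a"
  obtains V where "a \<noteq> 0" "\<not> a dvd 1" "valuation_overring V"
    "\<And>r. to_fract r / to_fract a \<in> V \<Longrightarrow> a dvd r"
  using assms unfolding valuation_element_iff by (elim conjE exE) simp

lemma valuation_element_divisor:
  assumes "valuation_element a" "b dvd a" "\<not> b dvd 1"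
  shows "valuation_element b"
proof -
  obtain V where V: "a \<noteq> 0" "valuation_overring V" "\<And>r. to_fract r / to_fract a \<in> V \<Longrightarrow> a dvd r"
    using assms(1) valuation_elementE by blast
  obtain c where c: "a = b * c" using assms(2) by auto
  have "b \<noteq> 0" "c \<noteq> 0" using V(1) c by auto
  have "b dvd r" if "to_fract r / to_fract b \<in> V" for r
  proof -
    have "to_fract (r * c) / to_fract a \<in> V"
      using that c \<open>c \<noteq> 0\<close> by simp
    hence "a dvd r * c" by (rule V(3))
    thus ?thesis using c \<open>c \<noteq> 0\<close> by simp
  qed
  thus ?thesis using V(2) \<open>b \<noteq> 0\<close> assms(3) unfolding valuation_element_iff by blast
qed

text \<open>
  Products of valuation elements are compared factor by factor: if \<open>b / (a\<^sub>1 \<dots> a\<^sub>n)\<close> lies in every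
  valuation overring, then so does \<open>b / a\<^sub>1\<close>, hence \<open>a\<^sub>1\<close> divides \<open>b\<close> and can be cancelled. So a VFD
  is the intersection of its valuation overrings.
\<close>

lemma prod_list_valuation_elements_dvd:
  assumes "\<forall>a\<in>set as. valuation_element a"
    and "\<And>V. valuation_overring V \<Longrightarrow> to_fract b / to_fract (prod_list as) \<in> V"
  shows "prod_list as dvd b"
  using assms
proof (induction as arbitrary: b)
  case (Cons a as)
  let ?p = "prod_list as"
  obtain V where V: "a \<noteq> 0" "valuation_overring V" "\<And>r. to_fract r / to_fract a \<in> V \<Longrightarrow> a dvd r"
    using valuation_elementE[of a] Cons.prems(1) by (metis list.set_intros(1))
  have p: "?p \<noteq> 0"
    using Cons.prems(1) by (auto simp: prod_list_zero_iff valuation_element_def)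
  have "to_fract ?p * (to_fract b / to_fract (prod_list (a # as))) \<in> V"
    using V(2) Cons.prems(2) overringD by (metis valuation_overring_overring)
  hence "to_fract b / to_fract a \<in> V" using p by (simp add: field_simps)
  then obtain b' where b': "b = a * b'" using V(3) by blast
  have "?p dvd b'"
  proof (rule Cons.IH)
    show "\<forall>a\<in>set as. valuation_element a" using Cons.prems(1) by simp
    show "to_fract b' / to_fract ?p \<in> W" if "valuation_overring W" for W
      using Cons.prems(2)[OF that] V(1) p b' by simp
  qed
  thus ?case using b' by simp
qed simp

lemma VFD_dvd_if_in_valuation_overrings:
  fixes a b :: "'a::idom"
  assumes "VFD TYPE('a)" "a \<noteq> 0"
    and "\<And>V. valuation_overring V \<Longrightarrow> to_fract b / to_fract a \<in> V"
  shows "a dvd b"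
proof (cases "a dvd 1")
  case True
  thus ?thesis by (meson dvd_trans one_dvd)
next
  case False
  then obtain as where "\<forall>c\<in>set as. valuation_element c" "a = prod_list as"
    using assms(1,2) unfolding VFD_def by blast
  thus ?thesis using assms(3) prod_list_valuation_elements_dvd by blast
qed

section \<open>Coprimality and primitivity with respect to divisorial closure\<close>

text \<open>
  For nonzero \<open>a\<close> and \<open>b\<close>, \<open>v_coprime a b\<close> is the condition \<open>(a, b)\<^sub>v = D\<close>, equivalently
  \<open>aD \<inter> bD = abD\<close>. It implies that every common divisor is a unit, but not conversely.
\<close>

definition v_coprime :: "'a::idom \<Rightarrow> 'a \<Rightarrow> bool" where
  "v_coprime a b \<longleftrightarrow> (\<forall>y. a dvd b * y \<longrightarrow> a dvd y)"

lemma v_coprimeD: "v_coprime a b \<Longrightarrow> a dvd b * y \<Longrightarrow> a dvd y"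
  unfolding v_coprime_def by blast

lemma v_coprime_sym:
  assumes "v_coprime a b" "a \<noteq> 0"
  shows "v_coprime b a"
  unfolding v_coprime_def
proof (intro allI impI)
  fix y assume "b dvd a * y"
  then obtain r where r: "a * y = b * r" by auto
  hence "a dvd b * r" by (metis dvd_triv_left)
  then obtain q where "r = a * q" using v_coprimeD[OF assms(1)] by blast
  hence "a * y = a * (b * q)" using r by (simp add: ac_simps)
  thus "b dvd y" using assms(2) by auto
qed

lemma v_coprime_mult_right:
  assumes "v_coprime a b" "v_coprime a c"
  shows "v_coprime a (b * c)"
  unfolding v_coprime_def
proof (intro allI impI)
  fix y assume "a dvd b * c * y"
  hence "a dvd b * (c * y)" by (simp only: mult.assoc)
  thus "a dvd y" by (rule v_coprimeD[OF assms(2) v_coprimeD[OF assms(1)]])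
qed

lemma v_coprime_unit_right:
  assumes "b dvd 1"
  shows "v_coprime a b"
  unfolding v_coprime_def
proof (intro allI impI)
  fix y assume *: "a dvd b * y"
  obtain c where "1 = b * c" using assms by auto
  hence "y = c * (b * y)" by (metis mult.assoc mult.commute mult_1)
  thus "a dvd y" using * by (metis dvd_mult)
qed

text \<open>
  \<open>v_primitive f\<close> is the condition \<open>c(f)\<^sub>v = D\<close> on the content ideal of \<open>f\<close>: a fraction \<open>r / s\<close> that
  multiplies all coefficients of \<open>f\<close> into \<open>D\<close> lies in \<open>D\<close>. The case \<open>s = 0\<close> excludes \<open>f = 0\<close>, also
  when \<open>D\<close> is a field.
\<close>

definition v_primitive :: "'a::idom poly \<Rightarrow> bool" where
  "v_primitive f \<longleftrightarrow> (\<forall>r s. (\<forall>i. s dvd r * coeff f i) \<longrightarrow> s dvd r)"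

lemma v_primitiveD: "v_primitive f \<Longrightarrow> (\<And>i. s dvd r * coeff f i) \<Longrightarrow> s dvd r"
  unfolding v_primitive_def by blast

text \<open>
  This is McCoy's theorem for the module \<open>F/D\<close>, where \<open>F\<close> is the quotient field: a polynomial that
  kills a nonzero element of \<open>(F/D)[X]\<close> kills a nonzero element of \<open>F/D\<close>. The fraction \<open>k / s\<close> stands
  for an element of \<open>(F/D)[X]\<close> that \<open>f\<close> kills. If it is not zero, then for the largest \<open>i\<close> with
  \<open>f\<^sub>i k \<notin> sD[X]\<close> the product \<open>f\<^sub>i k\<close> loses its leading coefficient modulo \<open>s\<close>, and the induction
  hypothesis applies to the rest.
\<close>

lemma v_primitive_cancel:
  assumes f: "v_primitive f" and "[:s:] dvd f * k"
  shows "[:s:] dvd k"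
  using assms(2)
proof (induction "degree k" arbitrary: k rule: less_induct)
  case less
  let ?n = "degree k"
  show ?case
  proof (rule ccontr)
    assume not: "\<not> [:s:] dvd k"
    have ex: "\<exists>i. \<not> [:s:] dvd smult (coeff f i) k"
    proof (rule ccontr)
      assume "\<not> ?thesis"
      hence "s dvd coeff k j * coeff f i" for i j
        by (auto simp: const_poly_dvd_iff mult.commute)
      hence "s dvd coeff k j" for j by (rule v_primitiveD[OF f])
      hence "[:s:] dvd k" by (simp add: const_poly_dvd_iff)
      thus False using not by simp
    qed
    define S where "S = {i. \<not> [:s:] dvd smult (coeff f i) k}"
    have "S \<subseteq> {..degree f}" 
    proof
      fix l assume "l \<in> S"
      hence "coeff f l \<noteq> 0" by (auto simp: S_def)
      thus "l \<in> {..degree f}" by (simp add: le_degree)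
    qed
    hence fin: "finite S" using finite_subset by blast
    define i where "i = Max S"
    have "i \<in> S" using ex fin unfolding i_def by (intro Max_in) (auto simp: S_def)
    have above: "[:s:] dvd smult (coeff f l) k" if "l > i" for l
    proof -
      have "l \<notin> S" using that Max_ge[OF fin] unfolding i_def by (auto simp: not_le[symmetric])
      thus ?thesis by (simp add: S_def)
    qed
    have "s dvd coeff (f * k) (i + ?n)" using less.prems by (simp add: const_poly_dvd_iff)
    also have "coeff (f * k) (i + ?n) =
        (\<Sum>l\<in>{..i + ?n} - {i}. coeff f l * coeff k (i + ?n - l)) + coeff f i * coeff k ?n"
      by (simp add: coeff_mult sum.remove[of _ i])
    finally have top: "s dvd (\<Sum>l\<in>{..i + ?n} - {i}. coeff f l * coeff k (i + ?n - l))
        + coeff f i * coeff k ?n" .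
    have "s dvd (\<Sum>l\<in>{..i + ?n} - {i}. coeff f l * coeff k (i + ?n - l))"
    proof (rule dvd_sum)
      fix l assume "l \<in> {..i + ?n} - {i}"
      hence "l < i \<or> l > i" by auto
      thus "s dvd coeff f l * coeff k (i + ?n - l)"
        using above[of l] by (auto simp: const_poly_dvd_iff coeff_eq_0)
    qed
    hence lead: "s dvd coeff f i * coeff k ?n" using top dvd_add_right_iff by blast
    define k' where "k' = smult (coeff f i) k - monom (coeff f i * coeff k ?n) ?n"
    have dm: "[:s:] dvd monom (coeff f i * coeff k ?n) ?n"
      using lead by (simp add: const_poly_dvd_iff)
    have "[:s:] dvd f * k'"
      using less.prems dm by (simp add: k'_def right_diff_distrib dvd_diff dvd_smult)
    moreover have "degree k' < ?n \<or> k' = 0"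
    proof -
      have "coeff k' j = 0" if "j \<ge> ?n" for j
        using that by (cases "j = ?n") (auto simp: k'_def coeff_eq_0)
      thus ?thesis by (metis leading_coeff_0_iff not_le)
    qed
    ultimately have "[:s:] dvd k'" using less.hyps by auto
    hence "[:s:] dvd k' + monom (coeff f i * coeff k ?n) ?n" using dm by (rule dvd_add)
    hence "[:s:] dvd smult (coeff f i) k" by (simp add: k'_def)
    thus False using \<open>i \<in> S\<close> by (simp add: S_def)
  qed
qed

section \<open>Uppers to zero in a UMT-domain\<close>

text \<open>
  \<open>in_v_content f h\<close> is the inclusion \<open>c(h) \<subseteq> c(f)\<^sub>v\<close> of content ideals.
\<close>

definition in_v_content :: "'a::idom poly \<Rightarrow> 'a poly \<Rightarrow> bool" where
  "in_v_content f h \<longleftrightarrow> (\<forall>r s. (\<forall>i. s dvd r * coeff f i) \<longrightarrow> (\<forall>j. s dvd r * coeff h j))"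

lemma in_v_contentD:
  "in_v_content f h \<Longrightarrow> (\<And>i. s dvd r * coeff f i) \<Longrightarrow> s dvd r * coeff h j"
  unfolding in_v_content_def by blast

lemma in_v_content_refl: "in_v_content f f"
  by (simp add: in_v_content_def)

lemma in_v_content_trans: "in_v_content f g \<Longrightarrow> in_v_content g h \<Longrightarrow> in_v_content f h"
  unfolding in_v_content_def by blast

lemma in_v_content_add: "in_v_content f g \<Longrightarrow> in_v_content f h \<Longrightarrow> in_v_content f (g + h)"
  unfolding in_v_content_def by (simp add: distrib_left)

lemma in_v_content_mult: "in_v_content f h \<Longrightarrow> in_v_content f (p * h)"
  unfolding in_v_content_def coeff_mult sum_distrib_left
  by (intro allI impI dvd_sum) (metis dvd_mult mult.left_commute)

lemma in_v_content_0_right: "in_v_content f 0"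
  by (simp add: in_v_content_def)

lemma in_v_content_0_left: "in_v_content 0 h \<Longrightarrow> h = 0"
  using in_v_contentD[of 0 h 0 1] by (auto intro: poly_eqI)

text \<open>
  Shifting \<open>g\<close> beyond the degree of \<open>f\<close> gives a polynomial whose coefficients are those of \<open>f\<close>
  and those of \<open>g\<close>.
\<close>

lemma in_v_content_shift:
  fixes f g :: "'a::idom poly"
  defines "h \<equiv> f + monom 1 (Suc (degree f)) * g"
  shows "in_v_content h f" "in_v_content h g"
proof -
  let ?n = "Suc (degree f)"
  have low: "coeff h i = coeff f i" if "i < ?n" for i
    using that by (simp add: h_def coeff_monom_mult)
  have high: "coeff h (?n + i) = coeff g i" for i
    by (simp add: h_def coeff_monom_mult coeff_eq_0)
  show "in_v_content h f"
    unfolding in_v_content_def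
  proof (intro allI impI)
    fix r s j assume *: "\<forall>i. s dvd r * coeff h i"
    show "s dvd r * coeff f j"
    proof (cases "j < ?n")
      case True
      thus ?thesis using *[rule_format, of j] low by simp
    qed (simp add: coeff_eq_0)
  qed
  show "in_v_content h g"
    unfolding in_v_content_def using high by metis
qed

text \<open>
  If no polynomial in \<open>Q\<close> is primitive, then the polynomials with coefficients in
  \<open>\<Union>\<^bsub>f \<in> Q\<^esub> c(f)\<^sub>v\<close> form a proper \<open>t\<close>-ideal of \<open>D[X]\<close> that contains \<open>Q\<close>. It also contains nonzero
  constants, which \<open>Q\<close> does not, and this contradicts the maximality of \<open>Q\<close>. The union is directed
  by the shifting trick, and to see that each \<open>c(f)\<^sub>v[X]\<close> is divisorial it suffices to test against
  constant fractions.
\<close>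

lemma upper_to_zero_contains_v_primitive:
  fixes Q :: "'a::idom poly set"
  assumes UMT: "UMT_domain TYPE('a)" and Q: "upper_to_zero Q"
  shows "\<exists>f\<in>Q. v_primitive f"
proof (rule ccontr)
  assume no: "\<not> ?thesis"
  have Q_mult: "h \<in> Q \<Longrightarrow> p * h \<in> Q" and Q_add: "g \<in> Q \<Longrightarrow> h \<in> Q \<Longrightarrow> g + h \<in> Q" and Q_0: "0 \<in> Q"
    for p g h
    using Q unfolding upper_to_zero_def prime_ideal_def module.subspace_def[OF module_times] by blast+
  have const_zero: "[:c:] \<in> Q \<Longrightarrow> c = 0" for c
    using Q unfolding upper_to_zero_def by (metis IntI pCons_eq_0_iff rangeI singletonD)
  obtain q where q: "q \<in> Q" "q \<noteq> 0"
    using Q Q_0 unfolding upper_to_zero_def by blast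
  define N where "N = {h. \<exists>f\<in>Q. in_v_content f h}"
  have dir: "\<exists>f\<in>Q. in_v_content f f1 \<and> in_v_content f f2" if "f1 \<in> Q" "f2 \<in> Q" for f1 f2
    using in_v_content_shift[of f1 f2] Q_add Q_mult that by blast
  have fin_dir: "\<exists>f\<in>Q. \<forall>h\<in>S. in_v_content f h" if "finite S" "S \<subseteq> N" for S
    using that
  proof (induction S rule: finite_induct)
    case empty
    thus ?case using q by auto
  next
    case (insert h S)
    then obtain f1 where f1: "f1 \<in> Q" "\<forall>h\<in>S. in_v_content f1 h" by auto
    obtain f2 where f2: "f2 \<in> Q" "in_v_content f2 h" using insert.prems by (auto simp: N_def)
    obtain f where "f \<in> Q" "in_v_content f f1" "in_v_content f f2"
      using dir[OF f1(1) f2(1)] by blast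
    thus ?case using f1(2) f2(2) in_v_content_trans by blast
  qed
  have QN: "Q \<subseteq> N" using in_v_content_refl by (auto simp: N_def)
  have subspace: "module.subspace fract_scale (to_fract ` {h. in_v_content f h})" for f :: "'a poly"
    unfolding module.subspace_def[OF module_fract_scale] fract_scale_def
  proof (intro conjI allI ballI)
    show "0 \<in> to_fract ` {h. in_v_content f h}"
      using in_v_content_0_right[of f] by (intro image_eqI[of _ _ 0]) simp_all
    fix x assume "x \<in> to_fract ` {h. in_v_content f h}"
    then obtain g where g: "x = to_fract g" "in_v_content f g" by auto
    show "to_fract p * x \<in> to_fract ` {h. in_v_content f h}" for p
      using in_v_content_mult[OF g(2), of p] g(1) by (auto simp flip: to_fract_mult)
    fix y assume "y \<in> to_fract ` {h. in_v_content f h}"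
    then obtain h where "y = to_fract h" "in_v_content f h" by auto
    thus "x + y \<in> to_fract ` {h. in_v_content f h}"
      using in_v_content_add[OF g(2)] g(1) by (auto simp flip: to_fract_add)
  qed
  have fractional: "fractional_ideal A"
    if "module.subspace fract_scale A" "A \<subseteq> range to_fract" for A :: "'a poly fract set"
    unfolding fractional_ideal_def using that by (intro conjI exI[of _ 1]) auto
  have "module.subspace fract_scale (to_fract ` N)"
    unfolding module.subspace_def[OF module_fract_scale] fract_scale_def
  proof (intro conjI allI ballI)
    show "0 \<in> to_fract ` N" using QN Q_0 by (intro image_eqI[of _ _ 0]) auto
    fix x assume "x \<in> to_fract ` N"
    then obtain g where g: "x = to_fract g" "g \<in> N" by auto
    show "to_fract p * x \<in> to_fract ` N" for p
      using g in_v_content_mult unfolding N_def by (fastforce simp flip: to_fract_mult)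
    fix y assume "y \<in> to_fract ` N"
    then obtain h where h: "y = to_fract h" "h \<in> N" by auto
    obtain f where "f \<in> Q" "in_v_content f g" "in_v_content f h"
      using fin_dir[of "{g, h}"] g h by auto
    hence "g + h \<in> N" using in_v_content_add unfolding N_def by blast
    thus "x + y \<in> to_fract ` N" using g h by (auto simp flip: to_fract_add)
  qed
  hence N_frac: "fractional_ideal (to_fract ` N)" by (rule fractional) auto
  have v_closure_N: "v_closure I \<subseteq> to_fract ` N"
    if I: "I \<subseteq> to_fract ` N" "I \<noteq> {0}" "fg_fractional_ideal I" for I
  proof
    fix z assume z: "z \<in> v_closure I"
    obtain S where S: "finite S" "I = module.span fract_scale S"
      using I(3) unfolding fg_fractional_ideal_def by blast
    have "S \<subseteq> to_fract ` N"
      using I(1) S(2) module.span_superset[OF module_fract_scale] by blast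
    then obtain S' where S': "S' \<subseteq> N" "finite S'" "S = to_fract ` S'"
      using finite_subset_image[OF S(1)] by metis
    obtain f where f: "f \<in> Q" "\<forall>h\<in>S'. in_v_content f h" using fin_dir S' by blast
    have I_f: "I \<subseteq> to_fract ` {h. in_v_content f h}"
      unfolding S(2) using f S'(3)
      by (intro module.span_minimal[OF module_fract_scale _ subspace]) auto
    have "0 \<in> I" unfolding S(2) by (rule module.span_zero[OF module_fract_scale])
    have "f \<noteq> 0"
    proof
      assume "f = 0"
      hence "I \<subseteq> {0}" using I_f in_v_content_0_left by fastforce
      thus False using I(2) \<open>0 \<in> I\<close> by blast
    qed
    have test: "z * w \<in> range to_fract" if "\<And>h. in_v_content f h \<Longrightarrow> w * to_fract h \<in> range to_fract" for w
    proof -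
      have "w \<in> inv_ideal I" unfolding inv_ideal_def using that I_f by blast
      thus ?thesis using z unfolding v_closure_def by (subst (asm) inv_ideal_def) blast
    qed
    obtain h where h: "z = to_fract h" using test[of 1] by auto
    have "in_v_content f h"
      unfolding in_v_content_def
    proof (intro allI impI)
      fix r s j assume rs: "\<forall>i. s dvd r * coeff f i"
      show "s dvd r * coeff h j"
      proof (cases "s = 0")
        case True
        hence "r = 0" using rs \<open>f \<noteq> 0\<close> by (auto simp: poly_eq_iff)
        thus ?thesis by simp
      next
        case False
        let ?w = "to_fract [:r:] / to_fract [:s:]"
        have in_range: "?w * to_fract g \<in> range to_fract \<longleftrightarrow> (\<forall>j. s dvd r * coeff g j)" for g
        proof -
          have "?w * to_fract g = to_fract (smult r g) / to_fract [:s:]"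
            by (simp flip: to_fract_mult)
          thus ?thesis using False quotient_in_range_iff[of "[:s:]" "smult r g"]
            by (simp add: const_poly_dvd_iff)
        qed
        have "z * ?w \<in> range to_fract"
          using in_range in_v_contentD[of f _ s r] rs by (intro test) blast
        thus ?thesis using in_range[of h] h by (simp add: mult.commute)
      qed
    qed
    thus "z \<in> to_fract ` N" using f(1) h by (auto simp: N_def)
  qed
  have N_v_closure: "x \<in> t_closure (to_fract ` N)" if "x \<in> to_fract ` N" for x
  proof -
    \<comment> \<open>The second generator only makes the ideal nonzero when \<open>x = 0\<close>.\<close>
    let ?I = "module.span fract_scale {x, to_fract q}"
    have sub: "?I \<subseteq> to_fract ` N"
      using that q(1) QN \<open>module.subspace fract_scale (to_fract ` N)\<close>
      by (intro module.span_minimal[OF module_fract_scale]) auto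
    have gens: "x \<in> ?I" "to_fract q \<in> ?I" by (auto intro: module.span_base[OF module_fract_scale])
    have "fractional_ideal ?I"
      using sub module.subspace_span[OF module_fract_scale] by (intro fractional) auto
    hence "fg_fractional_ideal ?I"
      unfolding fg_fractional_ideal_def by (intro conjI exI[of _ "{x, to_fract q}"]) auto
    moreover have "?I \<noteq> {0}" using gens(2) q(2) by auto
    moreover have "x \<in> v_closure ?I"
      using gens(1) by (auto simp: v_closure_def inv_ideal_def mult.commute)
    ultimately show ?thesis unfolding t_closure_def using sub by blast
  qed
  have "t_closure (to_fract ` N) \<subseteq> to_fract ` N"
    unfolding t_closure_def using v_closure_N by blast
  hence "t_closure (to_fract ` N) = to_fract ` N" using N_v_closure by blast
  moreover have "to_fract q \<in> to_fract ` N" using q(1) QN by blast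
  hence "to_fract ` N \<noteq> {0}" using q(2) by (metis singletonD to_fract_eq_0_iff)
  ultimately have "t_ideal (to_fract ` N)" using N_frac by (simp add: t_ideal_def)
  moreover have "to_fract 1 \<notin> to_fract ` N"
  proof
    assume "to_fract 1 \<in> to_fract ` N"
    hence "(1 :: 'a poly) \<in> N" by (auto simp del: to_fract_1)
    then obtain f where f: "f \<in> Q" "in_v_content f 1" by (auto simp: N_def)
    have "v_primitive f"
      unfolding v_primitive_def
    proof (intro allI impI)
      fix r s assume "\<forall>i. s dvd r * coeff f i"
      hence "s dvd r * coeff 1 0" by (intro in_v_contentD[OF f(2)]) blast
      thus "s dvd r" by simp
    qed
    thus False using no f(1) by blast
  qed
  ultimately have "proper_integral_t_ideal (to_fract ` N)"
    unfolding proper_integral_t_ideal_def by blast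
  moreover have "maximal_t_ideal (to_fract ` Q)" using UMT Q by (simp add: UMT_domain_def)
  ultimately have "to_fract ` N = to_fract ` Q"
    using QN unfolding maximal_t_ideal_def by blast
  hence "N = Q" by (simp add: inj_image_eq_iff inj_def)
  obtain i where i: "coeff q i \<noteq> 0" using q(2) by (auto simp: poly_eq_iff)
  have "in_v_content q [:coeff q i:]"
    by (auto simp: in_v_content_def coeff_pCons split: nat.splits)
  hence "[:coeff q i:] \<in> Q" using q(1) \<open>N = Q\<close> by (auto simp: N_def)
  thus False using const_zero i by blast
qed

section \<open>Greatest common divisors in a VFD that is a UMT-domain\<close>

text \<open>
  The Gauss lemma for a linear factor over a valuation domain: the one of \<open>a\<close>, \<open>x\<close> with the
  smaller value is recovered from the coefficients of the product one after the other, starting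
  at the lower or at the upper end.
\<close>

lemma valuation_overring_linear_factor:
  fixes a x :: "'a::idom fract"
  assumes V: "valuation_overring V" and "a \<noteq> 0" "x \<noteq> 0"
    and coeffs: "\<And>i. coeff ([:x, a:] * k) i \<in> V"
  shows "a * coeff k i \<in> V \<and> x * coeff k i \<in> V"
proof -
  note V' = overringD[OF valuation_overring_overring[OF V]]
  have c0: "x * coeff k 0 \<in> V" using coeffs[of 0] by simp
  have cSuc: "x * coeff k (Suc i) + a * coeff k i \<in> V" for i
    using coeffs[of "Suc i"] by simp
  consider "a / x \<in> V" | "x / a \<in> V" using valuation_overring_total[OF V] by blast
  thus ?thesis
  proof cases
    case 1
    have a_if_x: "a * coeff k i \<in> V" if "x * coeff k i \<in> V" for i
      using V'(3)[OF 1 that] \<open>x \<noteq> 0\<close> by simp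
    have "x * coeff k i \<in> V"
    proof (induction i)
      case (Suc i)
      thus ?case using V'(2)[OF cSuc[of i] a_if_x[of i]] by simp
    qed (rule c0)
    thus ?thesis using a_if_x by blast
  next
    case 2
    have x_if_a: "x * coeff k i \<in> V" if "a * coeff k i \<in> V" for i
      using V'(3)[OF 2 that] \<open>a \<noteq> 0\<close> by simp
    have "a * coeff k i \<in> V"
    proof (induction "Suc (degree k) - i" arbitrary: i)
      case 0
      hence "coeff k i = 0" by (intro coeff_eq_0) simp
      thus ?case using V'(1)[of 0] by simp
    next
      case (Suc n)
      hence "a * coeff k (Suc i) \<in> V" by simp
      thus ?case using V'(2)[OF cSuc[of i] x_if_a[of "Suc i"]] by simp
    qed
    thus ?thesis using x_if_a by blast
  qed
qed

lemma fract_poly_if_coeffs_in_range: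
  assumes "\<And>i. coeff p i \<in> range to_fract"
  shows "\<exists>q. p = fract_poly q"
  using assms
proof (induction p)
  case (pCons c p)
  have "coeff p i \<in> range to_fract" for i using pCons.prems[of "Suc i"] by simp
  then obtain q where "p = fract_poly q" using pCons.IH by blast
  moreover obtain d where "c = to_fract d" using pCons.prems[of 0] by auto
  ultimately have "pCons c p = fract_poly (pCons d q)" by (simp add: map_poly_pCons)
  thus ?case by blast
qed (auto intro: exI[of _ 0])

lemma upper_to_zero_root:
  fixes c :: "'a::idom fract"
  shows "upper_to_zero {h. poly (fract_poly h) c = 0}" (is "upper_to_zero ?Q")
proof -
  obtain r s where rs: "c = to_fract r / to_fract s" "s \<noteq> 0" by (rule fract_as_quotient)
  have "[:- r, s:] \<in> ?Q" using rs by (simp add: map_poly_pCons)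
  moreover have "[:- r, s:] \<noteq> 0" using rs(2) by simp
  ultimately have "?Q \<noteq> {0}" by blast
  moreover have "?Q \<inter> range (\<lambda>c. [:c:]) = {0}" by (auto simp: map_poly_pCons)
  moreover have "1 \<notin> ?Q" by simp
  hence "?Q \<noteq> UNIV" by blast
  hence "prime_ideal ?Q"
    unfolding prime_ideal_def module.subspace_def[OF module_times] by simp
  ultimately show ?thesis by (simp add: upper_to_zero_def)
qed

text \<open>
  This is the invertibility of the ideal \<open>(a, x)\<close> with respect to the \<open>v\<close>-operation: the
  coefficients of \<open>A\<close> and \<open>B\<close> are \<open>a h\<^sub>j\<close> and \<open>x h\<^sub>j\<close> for certain fractions \<open>h\<^sub>j\<close>, and no proper
  divisorial ideal contains them. The fractions are the coefficients of \<open>f / (aX + x)\<close> for a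
  primitive \<open>f\<close> in the upper to zero of \<open>aX + x\<close>, and the Gauss lemma over the valuation
  overrings puts \<open>a h\<^sub>j\<close> and \<open>x h\<^sub>j\<close> into \<open>D\<close>.
\<close>

lemma two_generated_ideal_v_invertible:
  fixes a x :: "'a::idom"
  assumes UMT: "UMT_domain TYPE('a)" and VFD: "VFD TYPE('a)" and "a \<noteq> 0" "x \<noteq> 0"
  obtains A B where "smult x A = smult a B" "v_primitive (B + pCons 0 A)"
proof -
  let ?c = "- to_fract x / to_fract a"
  obtain f where f: "poly (fract_poly f) ?c = 0" "v_primitive f"
    using upper_to_zero_contains_v_primitive[OF UMT upper_to_zero_root[of ?c]] by blast
  obtain k0 where k0: "fract_poly f = [:- ?c, 1:] * k0"
    using f(1) unfolding poly_eq_0_iff_dvd by auto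
  define k where "k = smult (1 / to_fract a) k0"
  have "[:to_fract x, to_fract a:] = smult (to_fract a) [:- ?c, 1:]"
    using \<open>a \<noteq> 0\<close> by simp
  hence k: "fract_poly f = [:to_fract x, to_fract a:] * k"
    using \<open>a \<noteq> 0\<close> unfolding k0 k_def by (simp add: smult_add_right)
  have in_V: "to_fract a * coeff k i \<in> V \<and> to_fract x * coeff k i \<in> V"
    if V: "valuation_overring V" for V i
  proof (rule valuation_overring_linear_factor[OF V])
    show "coeff ([:to_fract x, to_fract a:] * k) i \<in> V" for i
      unfolding k[symmetric]
      using overring_to_fract[OF valuation_overring_overring[OF V]] by (simp add: coeff_map_poly)
  qed (use \<open>a \<noteq> 0\<close> \<open>x \<noteq> 0\<close> in auto)
  have in_D: "y \<in> range to_fract" if y: "\<And>V. valuation_overring V \<Longrightarrow> y \<in> V" for y :: "'a fract"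
  proof -
    obtain r s where rs: "y = to_fract r / to_fract s" "s \<noteq> 0" by (rule fract_as_quotient)
    hence "s dvd r" using VFD_dvd_if_in_valuation_overrings[OF VFD] y by blast
    thus ?thesis using rs quotient_in_range_iff by blast
  qed
  have "coeff (smult (to_fract a) k) i \<in> range to_fract" for i using in_D in_V by simp
  then obtain A where A: "smult (to_fract a) k = fract_poly A"
    using fract_poly_if_coeffs_in_range by blast
  have "coeff (smult (to_fract x) k) i \<in> range to_fract" for i using in_D in_V by simp
  then obtain B where B: "smult (to_fract x) k = fract_poly B"
    using fract_poly_if_coeffs_in_range by blast
  have "fract_poly (smult x A) = fract_poly (smult a B)"
    by (simp del: fract_poly_eq_iff add: A[symmetric] B[symmetric] mult.commute)
  hence "smult x A = smult a B" by (simp only: fract_poly_eq_iff)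
  moreover have "fract_poly f = fract_poly (B + pCons 0 A)"
    unfolding k by (simp del: fract_poly_eq_iff add: A[symmetric] B[symmetric] map_poly_pCons)
  hence "f = B + pCons 0 A" by (simp only: fract_poly_eq_iff)
  ultimately show thesis using that f(2) by blast
qed

text \<open>
  The elements \<open>z\<close> with \<open>\<not> v_coprime a z\<close> are the zero divisors modulo \<open>a\<close>. If \<open>y\<close> witnesses this
  for \<open>z\<close>, then so does every other nonmultiple of \<open>a\<close> whose value is at least that of \<open>y\<close>. Hence,
  among the witnesses for finitely many \<open>z\<close>, the one of largest value serves for all of them. The
  fraction \<open>y / a\<close> then shows that the \<open>v\<close>-closure of the ideal generated by these \<open>z\<close> also consists
  of zero divisors, so that the zero divisors form a prime \<open>t\<close>-ideal.
\<close>

lemma common_zero_divisor_witness: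
  assumes a: "valuation_element a" and "finite Z" "\<And>z. z \<in> Z \<Longrightarrow> \<not> v_coprime a z"
  shows "\<exists>y. \<not> a dvd y \<and> (\<forall>z\<in>Z. a dvd z * y)"
proof -
  obtain V where V: "a \<noteq> 0" "\<not> a dvd 1" "valuation_overring V"
      "\<And>r. to_fract r / to_fract a \<in> V \<Longrightarrow> a dvd r"
    using valuation_elementE[OF a] by metis
  have mono: "a dvd z * y'"
    if "a dvd z * y" "to_fract y' / to_fract y \<in> V" "y \<noteq> 0" for z y y'
  proof (rule V(4))
    obtain q where q: "z * y = a * q" using \<open>a dvd z * y\<close> by auto
    have "to_fract z * to_fract y = to_fract a * to_fract q"
      using q by (simp flip: to_fract_mult)
    hence "to_fract (z * y') / to_fract a = to_fract q * (to_fract y' / to_fract y)"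
      using \<open>y \<noteq> 0\<close> V(1) by (simp add: field_simps)
    moreover note overringD[OF valuation_overring_overring[OF V(3)]]
    ultimately show "to_fract (z * y') / to_fract a \<in> V" using that(2) by metis
  qed
  show ?thesis
    using assms(2,3)
  proof (induction Z rule: finite_induct)
    case empty
    thus ?case using V(2) by blast
  next
    case (insert z Z)
    obtain y1 where y1: "\<not> a dvd y1" "\<forall>z\<in>Z. a dvd z * y1" using insert by blast
    obtain y2 where y2: "\<not> a dvd y2" "a dvd z * y2"
      using insert.prems[of z] by (auto simp: v_coprime_def)
    have "y1 \<noteq> 0" "y2 \<noteq> 0" using y1 y2 by auto
    consider "to_fract y1 / to_fract y2 \<in> V" | "to_fract y2 / to_fract y1 \<in> V"
      using valuation_overring_total[OF V(3)] by blast
    thus ?case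
    proof cases
      case 1
      hence "a dvd z * y1" using mono y2 \<open>y2 \<noteq> 0\<close> by blast
      thus ?thesis using y1 by blast
    next
      case 2
      hence "\<forall>z\<in>Z. a dvd z * y2" using mono y1 \<open>y1 \<noteq> 0\<close> by blast
      thus ?thesis using y2 by blast
    qed
  qed
qed

text \<open>
  If \<open>x\<close> is a zero divisor modulo \<open>a\<close>, then every zero divisor \<open>z\<close> modulo \<open>a\<close> is one modulo \<open>x\<close>:
  take a common witness \<open>y\<close> for \<open>x\<close> and \<open>z\<close> and put \<open>xy = au\<close>. Then \<open>x\<close> divides \<open>zu\<close>, but not \<open>u\<close>.
\<close>

lemma zero_divisors_subset:
  fixes a x z :: "'a::idom"
  assumes a: "valuation_element a" and x: "x \<noteq> 0"
    and "\<not> v_coprime a x" "\<not> v_coprime a z"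
  shows "\<not> v_coprime x z"
proof
  assume coprime: "v_coprime x z"
  have "a \<noteq> 0" using a by (simp add: valuation_element_def)
  obtain y where y: "\<not> a dvd y" "a dvd x * y" "a dvd z * y"
    using common_zero_divisor_witness[OF a, of "{x, z}"] assms(3,4) by auto
  obtain u where u: "x * y = a * u" using y(2) by (rule dvdE)
  obtain w where w: "z * y = a * w" using y(3) by (rule dvdE)
  have "a * (z * u) = z * (x * y)" by (simp add: u ac_simps)
  also have "\<dots> = a * (x * w)" using w by (metis mult.left_commute)
  finally have "z * u = x * w" using \<open>a \<noteq> 0\<close> by simp
  hence "x dvd u" using v_coprimeD[OF coprime] by simp
  then obtain v where "u = x * v" by auto
  hence "x * y = x * (a * v)" using u by (simp add: ac_simps)
  thus False using x y(1) by simp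
qed

text \<open>
  Write \<open>P(a)\<close> for the prime \<open>t\<close>-ideal of zero divisors modulo \<open>a\<close>. If \<open>x \<in> P(a)\<close>, then
  \<open>P(a) = P(x)\<close>. In the notation of the invertibility lemma, \<open>x (a h\<^sub>j) = a (x h\<^sub>j)\<close>. Thus
  \<open>a h\<^sub>j \<in> P(a)\<close> for all \<open>j\<close> unless \<open>a \<bar> x\<close>, and \<open>x h\<^sub>j \<in> P(x)\<close> for all \<open>j\<close> unless \<open>x \<bar> a\<close>. Both
  together would put all these elements into the proper \<open>t\<close>-ideal \<open>P(a)\<close>.
\<close>

lemma valuation_elements_comparable_or_v_coprime:
  fixes a x :: "'a::idom"
  assumes UMT: "UMT_domain TYPE('a)" and VFD: "VFD TYPE('a)"
    and a: "valuation_element a" and x: "valuation_element x"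
  shows "a dvd x \<or> x dvd a \<or> v_coprime a x"
proof (rule ccontr)
  assume "\<not> ?thesis"
  hence not: "\<not> a dvd x" "\<not> x dvd a" "\<not> v_coprime a x" by auto
  have nz: "a \<noteq> 0" "x \<noteq> 0" using a x by (auto simp: valuation_element_def)
  obtain A B where AB: "smult x A = smult a B" "v_primitive (B + pCons 0 A)"
    using two_generated_ideal_v_invertible[OF UMT VFD nz] by blast
  have eq: "coeff A j * x = a * coeff B j" for j
    using arg_cong[OF AB(1), of "\<lambda>p. coeff p j"] by (simp add: mult.commute)
  have "\<not> v_coprime a (coeff A j)" for j
  proof
    assume "v_coprime a (coeff A j)"
    moreover have "a dvd coeff A j * x" by (simp add: eq)
    ultimately show False using not(1) v_coprimeD by blast
  qed
  moreover have "\<not> v_coprime a (coeff B j)" for j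
  proof -
    have "\<not> v_coprime x a" using not(3) v_coprime_sym nz(2) by blast
    moreover have "\<not> v_coprime x (coeff B j)"
    proof
      assume "v_coprime x (coeff B j)"
      moreover have "x dvd coeff B j * a" using eq[of j] by (metis dvd_triv_right mult.commute)
      ultimately show False using not(2) v_coprimeD by blast
    qed
    ultimately show ?thesis by (rule zero_divisors_subset[OF x nz(1)])
  qed
  moreover have "finite (range (coeff p))" for p :: "'a poly"
    by (simp add: range_coeff)
  ultimately have "\<exists>y. \<not> a dvd y \<and> (\<forall>z\<in>range (coeff A) \<union> range (coeff B). a dvd z * y)"
    by (intro common_zero_divisor_witness[OF a]) auto
  then obtain y where y: "\<not> a dvd y"
      "\<And>z. z \<in> range (coeff A) \<union> range (coeff B) \<Longrightarrow> a dvd z * y" by blast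
  have "a dvd y * coeff (B + pCons 0 A) i" for i
  proof -
    have "a dvd y * coeff A j" "a dvd y * coeff B j" for j
      using y(2)[of "coeff A j"] y(2)[of "coeff B j"] by (simp_all add: mult.commute)
    thus ?thesis by (cases i) (simp_all add: distrib_left)
  qed
  hence "a dvd y" by (rule v_primitiveD[OF AB(2)])
  thus False using y(1) by blast
qed

lemma v_coprime_prod_list:
  assumes "\<And>b. b \<in> set bs \<Longrightarrow> v_coprime a b"
  shows "v_coprime a (prod_list bs)"
  using assms by (induction bs) (auto intro: v_coprime_mult_right v_coprime_unit_right)

text \<open>
  Common factors are cancelled until all pairs of remaining factors are coprime. Units must be
  admitted as factors, since they may arise as quotients of associated valuation elements.
\<close>

lemma exists_gcd_of_products:
  fixes as bs :: "'a::idom list"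
  assumes UMT: "UMT_domain TYPE('a)" and VFD: "VFD TYPE('a)"
    and "\<forall>a\<in>set as \<union> set bs. a dvd 1 \<or> valuation_element a"
  shows "\<exists>c a' b'. prod_list as = c * a' \<and> prod_list bs = c * b' \<and> v_coprime a' b'"
  using assms(3)
proof (induction "length as + length bs" arbitrary: as bs rule: less_induct)
  case less
  have nz: "a \<noteq> 0" if "a \<in> set as \<union> set bs" for a
    using that less.prems valuation_element_def by (metis dvd_0_left zero_neq_one)
  have cancel: "\<exists>c a' b'. prod_list xs = c * a' \<and> prod_list ys = c * b' \<and> v_coprime a' b'"
    if ab: "a \<in> set xs" "b \<in> set ys" "a dvd b"
      and size: "length xs + length ys = length as + length bs"
      and elems: "\<forall>a\<in>set xs \<union> set ys. a dvd 1 \<or> valuation_element a"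
    for xs ys :: "'a list" and a b
  proof -
    obtain xs1 xs2 where xs: "xs = xs1 @ a # xs2" using split_list[OF ab(1)] by auto
    obtain ys1 ys2 where ys: "ys = ys1 @ b # ys2" using split_list[OF ab(2)] by auto
    obtain e where e: "b = a * e" using ab(3) by auto
    have "e dvd 1 \<or> valuation_element e"
      using elems ab(2) e valuation_element_divisor[of b e]
      by (metis UnCI dvd_mult_right dvd_triv_right)
    hence "\<exists>c a' b'. prod_list (xs1 @ xs2) = c * a' \<and> prod_list (ys1 @ e # ys2) = c * b' \<and>
        v_coprime a' b'"
      using elems size by (intro less.hyps) (auto simp: xs ys)
    then obtain c a' b' where *: "prod_list (xs1 @ xs2) = c * a'"
        "prod_list (ys1 @ e # ys2) = c * b'" "v_coprime a' b'" by blast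
    have "prod_list xs = a * prod_list (xs1 @ xs2)"
      "prod_list ys = a * prod_list (ys1 @ e # ys2)"
      by (simp_all add: xs ys e ac_simps)
    hence "prod_list xs = (a * c) * a'" "prod_list ys = (a * c) * b'"
      using * by (simp_all add: mult.assoc)
    thus ?thesis using *(3) by blast
  qed
  show ?case
  proof (cases "\<exists>a\<in>set as. \<exists>b\<in>set bs. a dvd b \<or> b dvd a")
    case True
    then obtain a b where ab: "a \<in> set as" "b \<in> set bs" "a dvd b \<or> b dvd a" by blast
    show ?thesis
    proof (cases "a dvd b")
      case True
      thus ?thesis using cancel[OF ab(1,2)] less.prems by blast
    next
      case False
      hence "b dvd a" using ab(3) by blast
      then obtain c a' b' where *: "prod_list as = c * a'" "prod_list bs = c * b'" "v_coprime b' a'"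
        using cancel[OF ab(2,1)] less.prems by (metis Un_commute add.commute)
      have "prod_list bs \<noteq> 0" using nz by (auto simp: prod_list_zero_iff)
      hence "b' \<noteq> 0" using *(2) by auto
      thus ?thesis using * v_coprime_sym by blast
    qed
  next
    case False
    have "v_coprime b a" if "a \<in> set as" "b \<in> set bs" for a b
    proof (cases "a dvd 1")
      case True
      thus ?thesis by (rule v_coprime_unit_right)
    next
      case a: False
      have "\<not> b dvd 1" using False that by (meson dvd_trans one_dvd)
      hence "valuation_element a" "valuation_element b" using less.prems a that by auto
      from valuation_elements_comparable_or_v_coprime[OF UMT VFD this(2,1)]
      show ?thesis using False that by blast
    qed
    hence "v_coprime b (prod_list as)" if "b \<in> set bs" for b
      using that v_coprime_prod_list by blast
    hence "v_coprime (prod_list as) b" if "b \<in> set bs" for b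
      using that nz v_coprime_sym by blast
    hence "v_coprime (prod_list as) (prod_list bs)" by (rule v_coprime_prod_list)
    thus ?thesis
      by (intro exI[of _ 1] exI[of _ "prod_list as"] exI[of _ "prod_list bs"]) simp
  qed
qed

lemma VFD_exists_gcd:
  fixes a b :: "'a::idom"
  assumes "UMT_domain TYPE('a)" "VFD TYPE('a)" "a \<noteq> 0" "b \<noteq> 0"
  obtains c a' b' where "a = c * a'" "b = c * b'" "v_coprime a' b'"
proof -
  have prod: "\<exists>cs. (\<forall>d\<in>set cs. d dvd 1 \<or> valuation_element d) \<and> c = prod_list cs"
    if "c \<noteq> 0" for c :: 'a
  proof (cases "c dvd 1")
    case True
    thus ?thesis by (intro exI[of _ "[c]"]) simp
  next
    case False
    thus ?thesis using assms(2) that unfolding VFD_def by blast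
  qed
  obtain as bs where "\<forall>d\<in>set as \<union> set bs. d dvd 1 \<or> valuation_element d"
      "a = prod_list as" "b = prod_list bs"
    using prod[OF assms(3)] prod[OF assms(4)] by blast
  thus thesis using exists_gcd_of_products[OF assms(1,2)] that by blast
qed

text \<open>
  The coefficients are added one at a time. That the gcd of the new coefficient and the content so
  far has cofactors with \<open>(a', c')\<^sub>v = D\<close> is exactly what keeps the polynomial primitive.
\<close>

lemma VFD_content_primitive_part:
  fixes g :: "'a::idom poly"
  assumes "UMT_domain TYPE('a)" "VFD TYPE('a)" "g \<noteq> 0"
  obtains c g' where "g = smult c g'" "v_primitive g'"
proof -
  have "\<exists>c g'. g = smult c g' \<and> v_primitive g'"
    using assms(3)
  proof (induction g)
    case (pCons a p)
    show ?case
    proof (cases "p = 0")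
      case True
      have "v_primitive (1 :: 'a poly)"
        unfolding v_primitive_def by (metis lead_coeff_1 mult.right_neutral)
      thus ?thesis using True by (intro exI[of _ a] exI[of _ 1]) simp
    next
      case False
      then obtain c p' where p: "p = smult c p'" "v_primitive p'" using pCons.IH by blast
      have "c \<noteq> 0" using False p(1) by auto
      obtain d a' c' where *: "a = d * a'" "c = d * c'"
          "\<And>r s. s dvd r * a' \<Longrightarrow> s dvd r * c' \<Longrightarrow> s dvd r"
      proof (cases "a = 0")
        case True
        thus ?thesis using that[of c 0 1] by simp
      next
        case False
        obtain d a' c' where gcd: "a = d * a'" "c = d * c'" "v_coprime a' c'"
          using VFD_exists_gcd[OF assms(1,2) False \<open>c \<noteq> 0\<close>] by blast
        have "s dvd r" if rs: "s dvd r * a'" "s dvd r * c'" for r s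
        proof -
          obtain u where u: "r * a' = s * u" using rs(1) by auto
          obtain w where w: "r * c' = s * w" using rs(2) by auto
          show ?thesis
          proof (cases "s = 0")
            case True
            thus ?thesis using u False gcd(1) by auto
          next
            case s: False
            have "s * (c' * u) = c' * (s * u)" by (rule mult.left_commute)
            also have "\<dots> = a' * (r * c')" by (simp flip: u add: ac_simps)
            also have "\<dots> = s * (a' * w)" unfolding w by (rule mult.left_commute)
            finally have "c' * u = a' * w" using s by simp
            hence "a' dvd u" using v_coprimeD[OF gcd(3)] by simp
            then obtain v where "u = a' * v" by auto
            hence "a' * r = a' * (s * v)" using u by (simp add: ac_simps)
            moreover have "a' \<noteq> 0" using gcd(1) False by auto
            ultimately show ?thesis by simp
          qed
        qed
        thus ?thesis using gcd that by blast
      qed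
      have "v_primitive (pCons a' (smult c' p'))"
        unfolding v_primitive_def
      proof (intro allI impI)
        fix r s assume rs: "\<forall>i. s dvd r * coeff (pCons a' (smult c' p')) i"
        have "s dvd (r * c') * coeff p' i" for i
          using rs[rule_format, of "Suc i"] by (simp add: mult.assoc)
        hence "s dvd r * c'" by (rule v_primitiveD[OF p(2)])
        moreover have "s dvd r * a'" using rs[rule_format, of 0] by simp
        ultimately show "s dvd r" using *(3) by blast
      qed
      moreover have "pCons a p = smult d (pCons a' (smult c' p'))" using p * by simp
      ultimately show ?thesis by blast
    qed
  qed simp
  thus thesis using that by blast
qed

section \<open>Valuation elements of the polynomial ring\<close>

text \<open>
  A prime element \<open>p\<close> of positive degree is a valuation element because the localization of
  \<open>D[X]\<close> at \<open>(p)\<close> is a discrete valuation ring: degrees bound the powers of \<open>p\<close> that divide a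
  given polynomial.
\<close>

lemma split_off_power:
  fixes p :: "'a::idom poly"
  assumes "degree p > 0" "g \<noteq> 0"
  obtains n h where "g = p ^ n * h" "\<not> p dvd h"
proof -
  have "\<exists>n h. g = p ^ n * h \<and> \<not> p dvd h"
    using assms(2)
  proof (induction "degree g" arbitrary: g rule: less_induct)
    case less
    show ?case
    proof (cases "p dvd g")
      case True
      then obtain k where k: "g = p * k" by auto
      hence "k \<noteq> 0" "p \<noteq> 0" using less.prems by auto
      hence "degree k < degree g" using assms(1) by (simp add: k degree_mult_eq)
      then obtain n h where "k = p ^ n * h" "\<not> p dvd h" using less.hyps \<open>k \<noteq> 0\<close> by blast
      hence "g = p ^ Suc n * h \<and> \<not> p dvd h" by (simp add: k mult.assoc)
      thus ?thesis by blast
    next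
      case False
      thus ?thesis by (intro exI[of _ 0] exI[of _ g]) simp
    qed
  qed
  thus thesis using that by blast
qed

lemma prime_poly_valuation_element:
  fixes p :: "'a::idom poly"
  assumes p: "prime_elem p" and deg: "degree p > 0"
  shows "valuation_element p"
proof -
  define V where "V = {to_fract g / to_fract h | g h. \<not> p dvd h}"
  have V_I: "x = to_fract g / to_fract h \<Longrightarrow> \<not> p dvd h \<Longrightarrow> x \<in> V" for x g h
    by (auto simp: V_def)
  have ndvd_mult: "\<not> p dvd h * h'" if "\<not> p dvd h" "\<not> p dvd h'" for h h'
    using that prime_elem_dvd_mult_iff[OF p] by blast
  have "\<not> p dvd 1" using p by (rule prime_elem_not_unit)
  have "p \<noteq> 0" using deg by auto
  have "overring V"
    unfolding overring_def
  proof (intro conjI ballI)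
    show "range to_fract \<subseteq> V"
    proof
      fix x :: "'a poly fract" assume "x \<in> range to_fract"
      then obtain g where "x = to_fract g" by auto
      thus "x \<in> V" using V_I[of x g 1] \<open>\<not> p dvd 1\<close> by simp
    qed
    fix x y assume "x \<in> V" "y \<in> V"
    then obtain g h g' h' where x: "x = to_fract g / to_fract h" "\<not> p dvd h"
      and y: "y = to_fract g' / to_fract h'" "\<not> p dvd h'" by (auto simp: V_def)
    have nz: "h \<noteq> 0" "h' \<noteq> 0" using x(2) y(2) by auto
    have "x - y = to_fract (g * h' - g' * h) / to_fract (h * h')"
      using nz by (simp add: x(1) y(1) field_simps)
    thus "x - y \<in> V" using V_I ndvd_mult[OF x(2) y(2)] by blast
    have "x * y = to_fract (g * g') / to_fract (h * h')" by (simp add: x(1) y(1))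
    thus "x * y \<in> V" using V_I ndvd_mult[OF x(2) y(2)] by blast
  qed
  moreover have "x \<in> V \<or> inverse x \<in> V" for x
  proof (cases "x = 0")
    case True
    thus ?thesis using V_I[of x 0 1] \<open>\<not> p dvd 1\<close> by simp
  next
    case False
    obtain g h where x: "x = to_fract g / to_fract h" "h \<noteq> 0" by (rule fract_as_quotient)
    have "g \<noteq> 0" using False x(1) by auto
    obtain m g' where g: "g = p ^ m * g'" "\<not> p dvd g'"
      using split_off_power[OF deg \<open>g \<noteq> 0\<close>] by blast
    obtain n h' where h: "h = p ^ n * h'" "\<not> p dvd h'"
      using split_off_power[OF deg x(2)] by blast
    have nz: "g' \<noteq> 0" "h' \<noteq> 0" using g(2) h(2) by auto
    show ?thesis
    proof (cases "n \<le> m")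
      case True
      hence "g = p ^ n * (p ^ (m - n) * g')" by (simp add: g(1) flip: mult.assoc power_add)
      hence "x = to_fract (p ^ (m - n) * g') / to_fract h'"
        using \<open>p \<noteq> 0\<close> by (simp add: x(1) h(1))
      thus ?thesis using V_I h(2) by blast
    next
      case False
      hence "h = p ^ m * (p ^ (n - m) * h')" by (simp add: h(1) flip: mult.assoc power_add)
      hence "inverse x = to_fract (p ^ (n - m) * h') / to_fract g'"
        using \<open>p \<noteq> 0\<close> by (simp add: x(1) g(1))
      thus ?thesis using V_I g(2) by blast
    qed
  qed
  ultimately have "valuation_overring V" by (simp add: valuation_overring_def)
  moreover have "p dvd r" if in_V: "to_fract r / to_fract p \<in> V" for r
  proof -
    obtain g h where gh: "to_fract r / to_fract p = to_fract g / to_fract h" "\<not> p dvd h"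
      using in_V by (auto simp: V_def)
    have "h \<noteq> 0" using gh(2) by auto
    hence "to_fract (r * h) = to_fract (p * g)" using gh(1) \<open>p \<noteq> 0\<close> by (simp add: field_simps)
    hence "p dvd r * h" by (simp del: to_fract_mult)
    thus ?thesis using gh(2) prime_elem_dvd_mult_iff[OF p] by blast
  qed
  ultimately show ?thesis
    unfolding valuation_element_iff using \<open>p \<noteq> 0\<close> \<open>\<not> p dvd 1\<close> by blast
qed

lemma fract_poly_common_denominator:
  fixes k :: "'a::idom fract poly"
  obtains s K where "s \<noteq> 0" "smult (to_fract s) k = fract_poly K"
proof -
  have "\<exists>s K. s \<noteq> 0 \<and> smult (to_fract s) k = fract_poly K"
  proof (induction k)
    case 0
    show ?case by (intro exI[of _ 1] exI[of _ 0]) simp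
  next
    case (pCons c k)
    then obtain s K where K: "s \<noteq> 0" "smult (to_fract s) k = fract_poly K" by blast
    obtain r t where c: "c = to_fract r / to_fract t" "t \<noteq> 0" by (rule fract_as_quotient)
    have "smult (to_fract (s * t)) (pCons c k) =
        pCons (to_fract (s * r)) (smult (to_fract t) (smult (to_fract s) k))"
      using c by (simp add: mult.commute)
    also have "\<dots> = fract_poly (pCons (s * r) (smult t K))"
      by (simp add: K(2) map_poly_pCons)
    finally show ?case using K(1) c(2) by (intro exI[of _ "s * t"]) auto
  qed
  thus thesis using that by blast
qed

lemma v_primitive_fract_poly_dvd:
  fixes f :: "'a::idom poly"
  assumes f: "v_primitive f" and "fract_poly f dvd fract_poly g"
  shows "f dvd g"
proof -
  obtain k where k: "fract_poly g = fract_poly f * k" using assms(2) by auto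
  obtain s K where K: "s \<noteq> 0" "smult (to_fract s) k = fract_poly K"
    by (rule fract_poly_common_denominator)
  have "fract_poly (smult s g) = fract_poly f * smult (to_fract s) k" by (simp add: k)
  also have "\<dots> = fract_poly (f * K)" by (simp add: K(2))
  finally have eq: "smult s g = f * K" by (simp only: fract_poly_eq_iff)
  have "[:s:] dvd f * K" unfolding eq[symmetric] by (simp add: const_poly_dvd_iff)
  hence "[:s:] dvd K" by (rule v_primitive_cancel[OF f])
  then obtain L where "K = [:s:] * L" by auto
  hence "smult s g = smult s (f * L)" using eq by simp
  hence "g = f * L" using K(1) by (metis smult_cancel)
  thus ?thesis by simp
qed

text \<open>
  A factorization over the quotient field is made primitive in one factor; by the cancellation
  lemma the other factor then has coefficients in \<open>D\<close>. So a primitive polynomial that does not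
  split over \<open>D\<close> into factors of positive degree is irreducible over the quotient field, hence
  prime there, and the cancellation lemma brings primeness down to \<open>D[X]\<close>.
\<close>

lemma v_primitive_indecomposable_prime:
  fixes f :: "'a::idom poly"
  assumes UMT: "UMT_domain TYPE('a)" and VFD: "VFD TYPE('a)"
    and f: "v_primitive f" and deg: "degree f > 0"
    and indecomposable: "\<And>g h. f = g * h \<Longrightarrow> degree g = 0 \<or> degree h = 0"
  shows "prime_elem f"
proof -
  have "f \<noteq> 0" using deg by auto
  have deg_fract: "degree (fract_poly g) = degree g" for g :: "'a poly"
    by (intro degree_map_poly) simp
  have "irreducible (fract_poly f)"
  proof (rule irreducibleI)
    show "fract_poly f \<noteq> 0" using \<open>f \<noteq> 0\<close> by simp
    show "\<not> fract_poly f dvd 1"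
      using deg deg_fract[of f] by (auto simp: is_unit_iff_degree \<open>f \<noteq> 0\<close>)
    fix g h assume gh: "fract_poly f = g * h"
    hence nz: "g \<noteq> 0" "h \<noteq> 0" using \<open>f \<noteq> 0\<close> by auto
    obtain s G where G: "s \<noteq> 0" "smult (to_fract s) g = fract_poly G"
      by (rule fract_poly_common_denominator)
    obtain t H where H: "t \<noteq> 0" "smult (to_fract t) h = fract_poly H"
      by (rule fract_poly_common_denominator)
    have "G \<noteq> 0" using G nz(1) by auto
    obtain c G' where G': "G = smult c G'" "v_primitive G'"
      using VFD_content_primitive_part[OF UMT VFD \<open>G \<noteq> 0\<close>] by blast
    have "c \<noteq> 0" using G'(1) \<open>G \<noteq> 0\<close> by auto
    have "fract_poly (smult (s * t) f) = smult (to_fract s) g * smult (to_fract t) h"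
      by (simp add: gh ac_simps)
    also have "\<dots> = fract_poly (G * H)" by (simp add: G(2) H(2))
    finally have "smult (s * t) f = G * H" by (simp only: fract_poly_eq_iff)
    hence eq: "smult (s * t) f = G' * smult c H" by (simp add: G'(1))
    have "[:s * t:] dvd G' * smult c H" unfolding eq[symmetric] by (simp add: const_poly_dvd_iff)
    hence "[:s * t:] dvd smult c H" by (rule v_primitive_cancel[OF G'(2)])
    then obtain H' where H': "smult c H = [:s * t:] * H'" by auto
    hence "smult (s * t) f = smult (s * t) (G' * H')" using eq by simp
    hence "f = G' * H'" using G(1) H(1) by (metis mult_eq_0_iff smult_cancel)
    hence "degree G' = 0 \<or> degree H' = 0" by (rule indecomposable)
    moreover have "degree g = degree G'"
    proof -
      have "degree g = degree (fract_poly G)" using G(1) by (simp flip: G(2))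
      thus ?thesis using \<open>c \<noteq> 0\<close> by (simp add: deg_fract G'(1))
    qed
    moreover have "degree h = degree H'"
    proof -
      have "degree h = degree (fract_poly H)" using H(1) by (simp flip: H(2))
      also have "\<dots> = degree (smult c H)" using \<open>c \<noteq> 0\<close> by (simp add: deg_fract)
      finally show ?thesis using G(1) H(1) by (simp add: H')
    qed
    ultimately show "g dvd 1 \<or> h dvd 1" using nz by (auto simp: is_unit_iff_degree)
  qed
  hence prime: "prime_elem (fract_poly f)" by (rule field_poly_irreducible_imp_prime)
  show ?thesis
  proof (rule prime_elemI)
    show "\<not> f dvd 1" using deg by (metis degree_1 dvd_imp_degree_le leD zero_neq_one)
    fix g h assume "f dvd g * h"
    hence "fract_poly f dvd fract_poly (g * h)" by (rule fract_poly_dvd)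
    hence "fract_poly f dvd fract_poly g * fract_poly h" by simp
    hence "fract_poly f dvd fract_poly g \<or> fract_poly f dvd fract_poly h"
      by (rule prime_elem_dvd_multD[OF prime])
    thus "f dvd g \<or> f dvd h" using v_primitive_fract_poly_dvd[OF f] by blast
  qed (rule \<open>f \<noteq> 0\<close>)
qed

text \<open>
  The nonunits of a valuation domain form a prime ideal \<open>M\<close>, and then \<open>M[X]\<close> is prime in \<open>V[X]\<close>:
  in a product, the coefficient at the sum of the first positions of units is a unit.
\<close>

definition valuation_unit :: "'a::idom fract set \<Rightarrow> 'a fract \<Rightarrow> bool" where
  "valuation_unit V x \<longleftrightarrow> x \<in> V \<and> x \<noteq> 0 \<and> inverse x \<in> V"

lemma valuation_unit_mult:
  assumes "overring V" "valuation_unit V x" "valuation_unit V y"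
  shows "valuation_unit V (x * y)"
  using assms overring_mult[OF assms(1)] by (auto simp: valuation_unit_def)

lemma valuation_unit_mult_left:
  assumes "overring V" "valuation_unit V (x * y)" "x \<in> V" "y \<in> V"
  shows "valuation_unit V x"
proof -
  have "inverse (x * y) * y \<in> V" using assms overring_mult by (auto simp: valuation_unit_def)
  moreover have "inverse (x * y) * y = inverse x" using assms by (auto simp: valuation_unit_def)
  ultimately have "inverse x \<in> V" by metis
  thus ?thesis using assms by (auto simp: valuation_unit_def)
qed

text \<open>If \<open>x / y \<in> V\<close>, then \<open>y\<close> divides \<open>x + y\<close> in \<open>V\<close>, so \<open>x + y\<close> is a unit only if \<open>y\<close> is one.\<close>

lemma valuation_nonunit_add:
  assumes V: "valuation_overring V" and x: "x \<in> V" "\<not> valuation_unit V x"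
    and y: "y \<in> V" "\<not> valuation_unit V y"
  shows "\<not> valuation_unit V (x + y)"
proof -
  note V' = valuation_overring_overring[OF V]
  have *: "\<not> valuation_unit V (x + y)"
    if "x / y \<in> V" "x \<in> V" "y \<in> V" "\<not> valuation_unit V x" "\<not> valuation_unit V y" for x y
  proof (cases "y = 0")
    case False
    have "y * (x / y + 1) = x + y" using False by (simp add: field_simps)
    moreover have "x / y + 1 \<in> V" using that(1) overring_add[OF V'] overring_1[OF V'] by blast
    ultimately show ?thesis using valuation_unit_mult_left[OF V', of y "x / y + 1"] that by auto
  qed (use that in simp)
  show ?thesis
    using valuation_overring_total[OF V, of x y] *[of x y] *[of y x] x y by (auto simp: add.commute)
qed

lemma valuation_nonunit_sum:
  assumes V: "valuation_overring V"
    and "\<And>i. i \<in> A \<Longrightarrow> f i \<in> V \<and> \<not> valuation_unit V (f i)"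
  shows "sum f A \<in> V \<and> \<not> valuation_unit V (sum f A)"
  using assms(2)
proof (induction A rule: infinite_finite_induct)
  case (insert i A)
  thus ?case
    using valuation_nonunit_add[OF V] overring_add[OF valuation_overring_overring[OF V]] by simp
qed (simp_all add: valuation_unit_def overring_0[OF valuation_overring_overring[OF V]])

lemma unit_coeff_mult:
  assumes V: "valuation_overring V"
    and p: "\<And>i. coeff p i \<in> V" and q: "\<And>i. coeff q i \<in> V"
    and up: "\<exists>i. valuation_unit V (coeff p i)" and uq: "\<exists>i. valuation_unit V (coeff q i)"
  shows "\<exists>i. valuation_unit V (coeff (p * q) i)"
proof -
  note V' = valuation_overring_overring[OF V]
  define m where "m = (LEAST i. valuation_unit V (coeff p i))"
  define n where "n = (LEAST i. valuation_unit V (coeff q i))"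
  have m: "valuation_unit V (coeff p m)" "\<And>i. i < m \<Longrightarrow> \<not> valuation_unit V (coeff p i)"
    unfolding m_def using LeastI_ex[OF up] not_less_Least by blast+
  have n: "valuation_unit V (coeff q n)" "\<And>i. i < n \<Longrightarrow> \<not> valuation_unit V (coeff q i)"
    unfolding n_def using LeastI_ex[OF uq] not_less_Least by blast+
  let ?rest = "\<Sum>i\<in>{..m + n} - {m}. coeff p i * coeff q (m + n - i)"
  have rest: "?rest \<in> V \<and> \<not> valuation_unit V ?rest"
  proof (rule valuation_nonunit_sum[OF V])
    fix i assume "i \<in> {..m + n} - {m}"
    hence "i < m \<or> m + n - i < n" by auto
    hence "\<not> valuation_unit V (coeff p i * coeff q (m + n - i))"
      using m(2) n(2) valuation_unit_mult_left[OF V'] p q by (metis mult.commute)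
    thus "coeff p i * coeff q (m + n - i) \<in> V \<and>
        \<not> valuation_unit V (coeff p i * coeff q (m + n - i))"
      using overring_mult[OF V'] p q by blast
  qed
  have "coeff (p * q) (m + n) = coeff p m * coeff q n + ?rest"
    by (simp add: coeff_mult sum.remove[of _ m])
  moreover have "valuation_unit V (coeff p m * coeff q n + ?rest)"
  proof (rule ccontr)
    assume not: "\<not> valuation_unit V (coeff p m * coeff q n + ?rest)"
    have lead: "valuation_unit V (coeff p m * coeff q n)"
      by (rule valuation_unit_mult[OF V' m(1) n(1)])
    have "coeff p m * coeff q n + ?rest \<in> V"
      using rest lead overring_add[OF V'] by (auto simp: valuation_unit_def)
    moreover have "- ?rest \<in> V" using rest overring_diff[OF V' overring_0[OF V']] by fastforce
    moreover have "\<not> valuation_unit V (- ?rest)"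
      using rest overring_diff[OF V' overring_0[OF V'], of "inverse (- ?rest)"]
      by (auto simp: valuation_unit_def)
    ultimately have "\<not> valuation_unit V ((coeff p m * coeff q n + ?rest) + - ?rest)"
      using valuation_nonunit_add[OF V _ not] by blast
    thus False using lead by simp
  qed
  ultimately show ?thesis by metis
qed

lemma valuation_minimal_element:
  assumes V: "valuation_overring V" and "finite S" "S \<noteq> {}" "0 \<notin> S"
  shows "\<exists>c\<in>S. \<forall>x\<in>S. x / c \<in> V"
  using assms(2-)
proof (induction S rule: finite_ne_induct)
  case (singleton x)
  thus ?case using overring_1[OF valuation_overring_overring[OF V]] by auto
next
  case (insert y S)
  note V' = valuation_overring_overring[OF V]
  obtain c where c: "c \<in> S" "\<forall>x\<in>S. x / c \<in> V" using insert by auto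
  have nz: "c \<noteq> 0" "y \<noteq> 0" using c(1) insert.prems by auto
  consider "y / c \<in> V" | "c / y \<in> V" using valuation_overring_total[OF V] by blast
  thus ?case
  proof cases
    case 1
    thus ?thesis using c by blast
  next
    case 2
    have "x / y \<in> V" if "x \<in> S" for x
    proof -
      have "x / c * (c / y) \<in> V" using c(2) that 2 overring_mult[OF V'] by blast
      thus ?thesis using nz by simp
    qed
    moreover have "y / y \<in> V" using nz overring_1[OF V'] by simp
    ultimately show ?thesis by blast
  qed
qed

text \<open>
  A valuation overring \<open>V\<close> of \<open>D\<close> extends to the Gauss extension \<open>V[X]\<^bsub>M[X]\<^esub>\<close>. Its elements are
  written as quotients of polynomials over \<open>D\<close>; the scalar \<open>c\<close> takes both polynomials to \<open>V[X]\<close>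
  and the denominator out of \<open>M[X]\<close>.
\<close>

definition scale_poly :: "'a::idom fract \<Rightarrow> 'a poly \<Rightarrow> 'a fract poly" where
  "scale_poly c p = smult (1 / c) (fract_poly p)"

lemma coeff_scale_poly: "coeff (scale_poly c p) i = to_fract (coeff p i) / c"
  by (simp add: scale_poly_def coeff_map_poly)

lemma scale_poly_mult: "scale_poly c p * scale_poly d q = scale_poly (c * d) (p * q)"
  by (simp add: scale_poly_def mult.commute)

definition scaled_integral :: "'a::idom fract set \<Rightarrow> 'a fract \<Rightarrow> 'a poly \<Rightarrow> bool" where
  "scaled_integral V c p \<longleftrightarrow> (\<forall>i. coeff (scale_poly c p) i \<in> V)"

definition scaled_primitive :: "'a::idom fract set \<Rightarrow> 'a fract \<Rightarrow> 'a poly \<Rightarrow> bool" where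
  "scaled_primitive V c p \<longleftrightarrow>
     scaled_integral V c p \<and> (\<exists>i. valuation_unit V (coeff (scale_poly c p) i))"

definition Gauss_extension :: "'a::idom fract set \<Rightarrow> 'a poly fract set" where
  "Gauss_extension V = {to_fract p / to_fract q | p q. q \<noteq> 0 \<and>
     (\<exists>c. c \<noteq> 0 \<and> scaled_integral V c p \<and> scaled_primitive V c q)}"

lemma Gauss_extensionI:
  assumes "x = to_fract p / to_fract q" "q \<noteq> 0" "c \<noteq> 0"
    "scaled_integral V c p" "scaled_primitive V c q"
  shows "x \<in> Gauss_extension V"
  using assms unfolding Gauss_extension_def by blast

lemma scaled_integral_mult:
  assumes "overring V" "scaled_integral V c p" "scaled_integral V d q"
  shows "scaled_integral V (c * d) (p * q)"
  using assms(2,3) unfolding scaled_integral_def scale_poly_mult[symmetric] coeff_mult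
  by (blast intro: overring_sum[OF assms(1)] overring_mult[OF assms(1)])

lemma scaled_integral_diff:
  assumes "overring V" "scaled_integral V c p" "scaled_integral V c q"
  shows "scaled_integral V c (p - q)"
  using assms(2,3) overring_diff[OF assms(1)]
  by (simp add: scaled_integral_def coeff_scale_poly diff_divide_distrib)

lemma scaled_primitive_mult:
  assumes V: "valuation_overring V" and "scaled_primitive V c p" "scaled_primitive V d q"
  shows "scaled_primitive V (c * d) (p * q)"
  unfolding scaled_primitive_def
proof
  show "scaled_integral V (c * d) (p * q)"
    using assms(2,3) scaled_integral_mult[OF valuation_overring_overring[OF V]]
    by (simp add: scaled_primitive_def)
  show "\<exists>i. valuation_unit V (coeff (scale_poly (c * d) (p * q)) i)"
    using assms(2,3) unfolding scale_poly_mult[symmetric] scaled_primitive_def scaled_integral_def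
    by (intro unit_coeff_mult[OF V]) blast+
qed

lemma exists_scalar_for_pair:
  assumes V: "valuation_overring V" and q: "q \<noteq> 0"
  obtains c where "c \<noteq> 0" "scaled_integral V c p" "scaled_integral V c q"
    "scaled_primitive V c p \<or> scaled_primitive V c q"
proof -
  note V' = valuation_overring_overring[OF V]
  let ?C = "\<lambda>p. to_fract ` (range (coeff p) - {0})"
  have ne: "?C q \<noteq> {}" using q by (auto simp: poly_eq_iff)
  have "\<exists>c\<in>?C p \<union> ?C q. \<forall>x\<in>?C p \<union> ?C q. x / c \<in> V"
    using ne by (intro valuation_minimal_element[OF V]) (auto simp: range_coeff)
  then obtain c where c: "c \<in> ?C p \<union> ?C q" "\<forall>x\<in>?C p \<union> ?C q. x / c \<in> V" by blast
  have "c \<noteq> 0" using c(1) by auto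
  have integral: "scaled_integral V c r" if "r = p \<or> r = q" for r
    unfolding scaled_integral_def coeff_scale_poly
  proof
    fix i
    show "to_fract (coeff r i) / c \<in> V"
      using c(2) that overring_0[OF V'] by (cases "coeff r i = 0") auto
  qed
  have primitive: "scaled_primitive V c r" if "r = p \<or> r = q" "c \<in> ?C r" for r
  proof -
    obtain i where "c = to_fract (coeff r i)" using \<open>c \<in> ?C r\<close> by auto
    hence "valuation_unit V (coeff (scale_poly c r) i)"
      using \<open>c \<noteq> 0\<close> overring_1[OF V'] by (simp add: coeff_scale_poly valuation_unit_def)
    thus ?thesis using integral that(1) unfolding scaled_primitive_def by blast
  qed
  show thesis using that[OF \<open>c \<noteq> 0\<close>] integral primitive c(1) by blast
qed

lemma valuation_overring_Gauss_extension:
  assumes V: "valuation_overring V"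
  shows "valuation_overring (Gauss_extension V)"
  unfolding valuation_overring_def overring_def
proof (intro conjI ballI allI)
  note V' = valuation_overring_overring[OF V]
  show "range to_fract \<subseteq> Gauss_extension V"
  proof
    fix x :: "'a poly fract" assume "x \<in> range to_fract"
    then obtain p where p: "x = to_fract p" by auto
    have "valuation_unit V (coeff (scale_poly 1 1) 0)"
      using overring_1[OF V'] by (simp add: coeff_scale_poly valuation_unit_def)
    hence "scaled_primitive V 1 1"
      unfolding scaled_primitive_def scaled_integral_def
      using overring_to_fract[OF V'] by (auto simp: coeff_scale_poly)
    moreover have "scaled_integral V 1 p"
      unfolding scaled_integral_def using overring_to_fract[OF V'] by (simp add: coeff_scale_poly)
    ultimately show "x \<in> Gauss_extension V"
      using p by (intro Gauss_extensionI[of x p 1 1]) auto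
  qed
  fix x y assume "x \<in> Gauss_extension V" "y \<in> Gauss_extension V"
  then obtain p q c p' q' c' where
    x: "x = to_fract p / to_fract q" "q \<noteq> 0" "c \<noteq> 0" "scaled_integral V c p" "scaled_primitive V c q"
    and y: "y = to_fract p' / to_fract q'" "q' \<noteq> 0" "c' \<noteq> 0" "scaled_integral V c' p'"
      "scaled_primitive V c' q'"
    unfolding Gauss_extension_def by blast
  have int: "scaled_integral V c q" "scaled_integral V c' q'"
    using x(5) y(5) by (auto simp: scaled_primitive_def)
  have qq': "q * q' \<noteq> 0" "c * c' \<noteq> 0" "scaled_primitive V (c * c') (q * q')"
    using x y scaled_primitive_mult[OF V] by auto
  have "scaled_integral V (c * c') (p * q' - q * p')"
    by (intro scaled_integral_diff[OF V'] scaled_integral_mult[OF V'] x y int)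
  moreover have "x - y = to_fract (p * q' - q * p') / to_fract (q * q')"
    using x(2) y(2) by (simp add: x(1) y(1) field_simps)
  ultimately show "x - y \<in> Gauss_extension V" using qq' by (intro Gauss_extensionI)
  have "scaled_integral V (c * c') (p * p')" by (intro scaled_integral_mult[OF V'] x y)
  moreover have "x * y = to_fract (p * p') / to_fract (q * q')" by (simp add: x(1) y(1))
  ultimately show "x * y \<in> Gauss_extension V" using qq' by (intro Gauss_extensionI)
next
  fix x :: "'a poly fract"
  obtain p q where x: "x = to_fract p / to_fract q" "q \<noteq> 0" by (rule fract_as_quotient)
  obtain c where c: "c \<noteq> 0" "scaled_integral V c p" "scaled_integral V c q"
      "scaled_primitive V c p \<or> scaled_primitive V c q"
    by (rule exists_scalar_for_pair[OF V x(2)])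
  show "x \<in> Gauss_extension V \<or> inverse x \<in> Gauss_extension V"
  proof (cases "scaled_primitive V c q")
    case True
    thus ?thesis using Gauss_extensionI[OF x c(1,2)] by blast
  next
    case False
    hence prim: "scaled_primitive V c p" using c(4) by blast
    hence "p \<noteq> 0" by (auto simp: scaled_primitive_def coeff_scale_poly valuation_unit_def)
    moreover have "inverse x = to_fract q / to_fract p" by (simp add: x(1))
    ultimately show ?thesis using Gauss_extensionI c(1,3) prim by blast
  qed
qed

lemma valuation_element_const:
  fixes a :: "'a::idom"
  assumes "valuation_element a"
  shows "valuation_element [:a:]"
proof -
  obtain V where V: "a \<noteq> 0" "\<not> a dvd 1" "valuation_overring V"
      "\<And>r. to_fract r / to_fract a \<in> V \<Longrightarrow> a dvd r"
    using valuation_elementE[OF assms] by metis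
  note V' = valuation_overring_overring[OF V(3)]
  have "[:a:] dvd r" if in_ext: "to_fract r / to_fract [:a:] \<in> Gauss_extension V" for r
  proof (cases "r = 0")
    case False
    obtain p q c where pq: "to_fract r / to_fract [:a:] = to_fract p / to_fract q" "q \<noteq> 0"
        "c \<noteq> 0" "scaled_integral V c p" "scaled_primitive V c q"
      using in_ext unfolding Gauss_extension_def by blast
    have "to_fract (q * r) = to_fract ([:a:] * p)"
      using pq(1,2) V(1) by (simp add: field_simps del: to_fract_mult flip: to_fract_mult)
    hence eq: "q * r = [:a:] * p" by (simp only: to_fract_eq_iff)
    obtain e where e: "e \<noteq> 0" "scaled_integral V e r" "scaled_primitive V e r"
      using exists_scalar_for_pair[OF V(3) False, of r] by blast
    obtain i where "valuation_unit V (coeff (scale_poly (c * e) (q * r)) i)"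
      using scaled_primitive_mult[OF V(3) pq(5) e(3)] by (auto simp: scaled_primitive_def)
    \<comment> \<open>The unit coefficient of \<open>qr = ap\<close> at scale \<open>ce\<close> is \<open>a / e\<close> times an element of \<open>V\<close>. So \<open>e / a\<close>
      lies in \<open>V\<close>: the content \<open>e\<close> of \<open>r\<close> over \<open>V\<close> is a multiple of \<open>a\<close>.\<close>
    hence unit: "valuation_unit V (to_fract a / e * (to_fract (coeff p i) / c))"
      by (simp add: eq coeff_scale_poly ac_simps)
    define u where "u = to_fract a / e * (to_fract (coeff p i) / c)"
    have "inverse u \<in> V" using unit by (simp only: u_def valuation_unit_def)
    moreover have "to_fract (coeff p i) / c \<in> V"
      using pq(4) by (simp add: scaled_integral_def coeff_scale_poly)
    ultimately have "inverse u * (to_fract (coeff p i) / c) \<in> V" by (rule overring_mult[OF V'])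
    moreover have "inverse u * (to_fract (coeff p i) / c) = e / to_fract a"
      using unit V(1) e(1) pq(3) by (simp add: u_def valuation_unit_def field_simps)
    ultimately have e_a: "e / to_fract a \<in> V" by metis
    have "a dvd coeff r j" for j
    proof (rule V(4))
      have "to_fract (coeff r j) / e \<in> V"
        using e(2) by (simp add: scaled_integral_def coeff_scale_poly)
      hence "to_fract (coeff r j) / e * (e / to_fract a) \<in> V" using e_a by (rule overring_mult[OF V'])
      thus "to_fract (coeff r j) / to_fract a \<in> V" using e(1) by simp
    qed
    thus ?thesis by (simp add: const_poly_dvd_iff)
  qed simp
  thus ?thesis
    unfolding valuation_element_iff
    using V(1,2) valuation_overring_Gauss_extension[OF V(3)] by (auto simp: is_unit_const_poly_iff)
qed

text \<open>Conversely, a valuation overring of \<open>D[X]\<close> is restricted to the constant fractions.\<close>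

lemma valuation_element_of_const:
  fixes a :: "'a::idom"
  assumes "valuation_element [:a:]"
  shows "valuation_element a"
proof -
  obtain W where W: "[:a:] \<noteq> 0" "\<not> [:a:] dvd 1" "valuation_overring W"
      "\<And>r. to_fract r / to_fract [:a:] \<in> W \<Longrightarrow> [:a:] dvd r"
    using valuation_elementE[OF assms] by metis
  note W' = overringD[OF valuation_overring_overring[OF W(3)]]
  define V where
    "V = {to_fract r / to_fract s | r s. s \<noteq> 0 \<and> to_fract [:r:] / to_fract [:s:] \<in> W}"
  have V_I: "x \<in> V"
    if "x = to_fract r / to_fract s" "s \<noteq> 0" "to_fract [:r:] / to_fract [:s:] \<in> W" for x r s
    using that by (auto simp: V_def)
  have "overring V"
    unfolding overring_def
  proof (intro conjI ballI)
    show "range to_fract \<subseteq> V"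
    proof
      fix x :: "'a fract" assume "x \<in> range to_fract"
      then obtain r where "x = to_fract r" by auto
      thus "x \<in> V" using V_I[of x r 1] W'(1) by (simp flip: one_pCons)
    qed
    fix x y assume "x \<in> V" "y \<in> V"
    then obtain r s r' s' where
      x: "x = to_fract r / to_fract s" "s \<noteq> 0" "to_fract [:r:] / to_fract [:s:] \<in> W"
      and y: "y = to_fract r' / to_fract s'" "s' \<noteq> 0" "to_fract [:r':] / to_fract [:s':] \<in> W"
      by (auto simp: V_def)
    have nz: "s * s' \<noteq> 0" using x(2) y(2) by simp
    have "to_fract [:r:] / to_fract [:s:] - to_fract [:r':] / to_fract [:s':] =
        to_fract ([:r:] * [:s':] - [:r':] * [:s:]) / to_fract ([:s:] * [:s':])"
      unfolding to_fract_mult to_fract_diff using x(2) y(2) by (simp add: diff_frac_eq)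
    hence "to_fract [:r * s' - r' * s:] / to_fract [:s * s':] \<in> W"
      using W'(2)[OF x(3) y(3)] by (simp add: ac_simps)
    moreover have "x - y = to_fract (r * s' - r' * s) / to_fract (s * s')"
      using x(2) y(2) by (simp add: x(1) y(1) diff_frac_eq)
    ultimately show "x - y \<in> V" using nz V_I by blast
    have "to_fract [:r:] / to_fract [:s:] * (to_fract [:r':] / to_fract [:s':]) =
        to_fract ([:r:] * [:r':]) / to_fract ([:s:] * [:s':])"
      unfolding to_fract_mult by simp
    hence "to_fract [:r * r':] / to_fract [:s * s':] \<in> W"
      using W'(3)[OF x(3) y(3)] by (simp add: ac_simps)
    moreover have "x * y = to_fract (r * r') / to_fract (s * s')" by (simp add: x(1) y(1))
    ultimately show "x * y \<in> V" using nz V_I by blast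
  qed
  moreover have "x \<in> V \<or> inverse x \<in> V" for x
  proof -
    obtain r s where x: "x = to_fract r / to_fract s" "s \<noteq> 0" by (rule fract_as_quotient)
    show ?thesis
    proof (cases "r = 0")
      case True
      thus ?thesis using V_I[of x 0 1] W'(1)[of 0] x by simp
    next
      case False
      have "inverse x = to_fract s / to_fract r" by (simp add: x(1))
      thus ?thesis using valuation_overring_total[OF W(3)] V_I x False by metis
    qed
  qed
  ultimately have "valuation_overring V" by (simp add: valuation_overring_def)
  moreover have "a dvd z" if in_V: "to_fract z / to_fract a \<in> V" for z
  proof -
    obtain r s where rs: "to_fract z / to_fract a = to_fract r / to_fract s" "s \<noteq> 0"
        "to_fract [:r:] / to_fract [:s:] \<in> W" using in_V by (auto simp: V_def)
    have "to_fract (z * s) = to_fract (r * a)" using rs(1,2) W(1) by (simp add: frac_eq_eq)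
    hence "z * s = r * a" by (simp only: to_fract_eq_iff)
    hence "[:z:] * [:s:] = [:r:] * [:a:]" by (simp add: mult.commute)
    hence "to_fract [:z:] * to_fract [:s:] = to_fract [:r:] * to_fract [:a:]"
      by (simp only: flip: to_fract_mult)
    hence "to_fract [:z:] / to_fract [:a:] = to_fract [:r:] / to_fract [:s:]"
      using rs(2) W(1) by (simp add: frac_eq_eq)
    hence "[:a:] dvd [:z:]" using rs(3) W(4) by metis
    thus ?thesis by simp
  qed
  ultimately show ?thesis
    unfolding valuation_element_iff using W(1,2) by (auto simp: is_unit_const_poly_iff)
qed

section \<open>Transfer of valuation factorization\<close>

text \<open>
  The unit in front admits units themselves, so that the notion is multiplicative without exceptions.
\<close>

definition factorable :: "'a::idom \<Rightarrow> bool" where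
  "factorable x \<longleftrightarrow>
     (\<exists>u as. u dvd 1 \<and> (\<forall>b\<in>set as. valuation_element b) \<and> x = u * prod_list as)"

lemma factorable_mult:
  assumes "factorable x" "factorable y"
  shows "factorable (x * y)"
proof -
  obtain u as where x: "u dvd 1" "\<forall>b\<in>set as. valuation_element b" "x = u * prod_list as"
    using assms(1) unfolding factorable_def by blast
  obtain v bs where y: "v dvd 1" "\<forall>b\<in>set bs. valuation_element b" "y = v * prod_list bs"
    using assms(2) unfolding factorable_def by blast
  have "u * v dvd 1" using mult_dvd_mono[OF x(1) y(1)] by simp
  moreover have "x * y = u * v * prod_list (as @ bs)" by (simp add: x(3) y(3) ac_simps)
  moreover have "\<forall>b\<in>set (as @ bs). valuation_element b" using x(2) y(2) by auto
  ultimately show ?thesis unfolding factorable_def by blast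
qed

lemma factorable_unit: "u dvd 1 \<Longrightarrow> factorable u"
  unfolding factorable_def by (intro exI[of _ u] exI[of _ "[]"]) simp

lemma factorable_valuation_element: "valuation_element a \<Longrightarrow> factorable a"
  unfolding factorable_def by (intro exI[of _ 1] exI[of _ "[a]"]) simp

lemma factorable_prod_list:
  "(\<And>b. b \<in> set as \<Longrightarrow> factorable b) \<Longrightarrow> factorable (prod_list as)"
  by (induction as) (auto intro: factorable_mult factorable_unit)

lemma VFD_iff_factorable:
  "VFD TYPE('a::idom) \<longleftrightarrow> (\<forall>x::'a. x \<noteq> 0 \<longrightarrow> factorable x)"
proof
  assume VFD: "VFD TYPE('a)"
  show "\<forall>x::'a. x \<noteq> 0 \<longrightarrow> factorable x"
  proof (intro allI impI)
    fix x :: 'a assume "x \<noteq> 0"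
    show "factorable x"
    proof (cases "x dvd 1")
      case True
      thus ?thesis by (rule factorable_unit)
    next
      case False
      then obtain as where "\<forall>b\<in>set as. valuation_element b" "x = prod_list as"
        using VFD \<open>x \<noteq> 0\<close> unfolding VFD_def by blast
      thus ?thesis using factorable_prod_list factorable_valuation_element by blast
    qed
  qed
next
  assume *: "\<forall>x::'a. x \<noteq> 0 \<longrightarrow> factorable x"
  show "VFD TYPE('a)"
    unfolding VFD_def
  proof (intro allI impI)
    fix x :: 'a assume x: "x \<noteq> 0" "\<not> x dvd 1"
    then obtain u as where as: "u dvd 1" "\<forall>b\<in>set as. valuation_element b" "x = u * prod_list as"
      using * unfolding factorable_def by blast
    then obtain a as' where as': "as = a # as'" using x(2) by (cases as) auto
    obtain v where v: "1 = u * v" using as(1) by auto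
    have "v * (u * a) = a" using v by (metis mult.assoc mult.commute mult_1)
    hence "u * a dvd a" by (metis dvd_triv_right)
    moreover have "valuation_element a" using as(2) as' by simp
    moreover have "\<not> u * a dvd 1"
      using \<open>valuation_element a\<close> by (auto simp: valuation_element_def dest: dvd_mult_right)
    ultimately have "valuation_element (u * a)" by (metis valuation_element_divisor)
    hence "\<forall>b\<in>set ((u * a) # as'). valuation_element b" using as(2) as' by simp
    moreover have "x = prod_list ((u * a) # as')" using as(3) as' by (simp add: mult.assoc)
    ultimately show "\<exists>as. (\<forall>b\<in>set as. valuation_element b) \<and> x = prod_list as" by blast
  qed
qed

lemma const_poly_prod_list: "prod_list (map (\<lambda>d. [:d:]) ds) = [:prod_list ds:]"
  for ds :: "'a::idom list"
  by (induction ds) simp_all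

lemma VFD_poly_if_VFD:
  assumes UMT: "UMT_domain TYPE('a::idom)" and VFD: "VFD TYPE('a)"
  shows "VFD TYPE('a poly)"
  unfolding VFD_iff_factorable
proof (intro allI impI)
  have const: "factorable [:c:]" if "c \<noteq> 0" for c :: 'a
  proof -
    have "factorable c" using VFD that unfolding VFD_iff_factorable by blast
    then obtain u as where as: "u dvd 1" "\<forall>b\<in>set as. valuation_element b" "c = u * prod_list as"
      unfolding factorable_def by blast
    have "[:c:] = [:u:] * prod_list (map (\<lambda>d. [:d:]) as)"
      by (simp add: as(3) const_poly_prod_list)
    moreover have "[:u:] dvd 1" using as(1) by (simp add: is_unit_const_poly_iff)
    moreover have "\<forall>b\<in>set (map (\<lambda>d. [:d:]) as). valuation_element b"
      using as(2) valuation_element_const by auto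
    ultimately show ?thesis unfolding factorable_def by blast
  qed
  fix f :: "'a poly" assume "f \<noteq> 0"
  thus "factorable f"
  proof (induction "degree f" arbitrary: f rule: less_induct)
    case less
    obtain c f' where f': "f = smult c f'" "v_primitive f'"
      using VFD_content_primitive_part[OF UMT VFD less.prems] by blast
    have "c \<noteq> 0" "f' \<noteq> 0" using f'(1) less.prems by auto
    have deg: "degree f' = degree f" using f'(1) \<open>c \<noteq> 0\<close> by simp
    have "factorable f'"
    proof (cases "\<exists>g h. f' = g * h \<and> degree g > 0 \<and> degree h > 0")
      case True
      then obtain g h where gh: "f' = g * h" "degree g > 0" "degree h > 0" by blast
      hence nz: "g \<noteq> 0" "h \<noteq> 0" by auto
      hence "degree f = degree g + degree h" using gh(1) deg by (simp add: degree_mult_eq)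
      hence "factorable g" "factorable h" using less.hyps nz gh by auto
      thus ?thesis unfolding gh(1) by (rule factorable_mult)
    next
      case False
      show ?thesis
      proof (cases "degree f' = 0")
        case True
        then obtain d where "f' = [:d:]" by (rule degree_eq_zeroE)
        thus ?thesis using const \<open>f' \<noteq> 0\<close> by auto
      next
        case pos: False
        have "prime_elem f'"
          using f'(2) pos False by (intro v_primitive_indecomposable_prime[OF UMT VFD]) auto
        hence "valuation_element f'" using pos by (intro prime_poly_valuation_element) auto
        thus ?thesis by (rule factorable_valuation_element)
      qed
    qed
    moreover have "f = [:c:] * f'" using f'(1) by simp
    ultimately show ?case using const[OF \<open>c \<noteq> 0\<close>] factorable_mult by metis
  qed
qed

lemma VFD_if_VFD_poly:
  assumes "VFD TYPE('a::idom poly)"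
  shows "VFD TYPE('a)"
  unfolding VFD_def
proof (intro allI impI)
  fix c :: 'a assume c: "c \<noteq> 0" "\<not> c dvd 1"
  hence "[:c:] \<noteq> 0" "\<not> [:c:] dvd 1" by (auto simp: is_unit_const_poly_iff)
  then obtain ps where ps: "\<forall>p\<in>set ps. valuation_element p" "[:c:] = prod_list ps"
    using assms unfolding VFD_def by blast
  define ds where "ds = map (\<lambda>p. coeff p 0) ps"
  have "[:coeff p 0:] = p" if "p \<in> set ps" for p
  proof -
    have "p dvd [:c:]" using that ps(2) by (simp add: prod_list_dvd)
    hence "degree p = 0" using c(1) dvd_imp_degree_le[of p "[:c:]"] by simp
    thus ?thesis by (metis coeff_pCons_0 degree_eq_zeroE)
  qed
  hence ps_ds: "ps = map (\<lambda>d. [:d:]) ds" by (simp add: ds_def map_idI)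
  have "[:c:] = [:prod_list ds:]" using ps(2) ps_ds const_poly_prod_list by metis
  moreover have "\<forall>d\<in>set ds. valuation_element d"
    using ps(1) valuation_element_of_const unfolding ps_ds by auto
  ultimately show "\<exists>as. (\<forall>b\<in>set as. valuation_element b) \<and> c = prod_list as" by auto
qed

theorem corollary2p7:
  assumes "UMT_domain TYPE('a::idom)"
  shows "VFD TYPE('a) \<longleftrightarrow> VFD TYPE('a poly)"
  using VFD_poly_if_VFD[OF assms] VFD_if_VFD_poly by blast

end
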